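(* Let $p>2$ be a prime. Then \[ \sum_{k=0}^{\frac{p-3}{2}}\frac{92k^2+61k+9}{(2k+1)64^k}\binom{2k}{k}\binom{3k}{k}\binom{4k}{2k} \equiv 6p+\left(16p^2+52p^3-48p^3q_p(2)\right)\left(\frac{-1}{p}\right)-12p^3\left(\frac{-1}{p}\right)E_{p-3} \pmod{p^4}. \]
   Context: Here $\left(\frac{\cdot}{p}\right)$ is the Legendre symbol, $q_p(2)=\frac{2^{p-1}-1}{p}$ is the Fermat quotient of $2$ with respect to $p$, and $E_n$ denotes the $n$-th Euler number, defined by $\frac{2}{e^x+e^{-x}}=\sum_{n\ge 0}E_n\frac{x^n}{n!}$. Congruences between rational numbers whose denominators are prime to $p$ are understood in the ring of $p$-integral rationals: $a\equiv b \pmod{p^m}$ means $(a-b)/p^m$ is a rational number with denominator prime to $p$. *)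

theory Defs
  imports
    "HOL-Number_Theory.Number_Theory"
    "HOL-Computational_Algebra.Formal_Power_Series"
begin

definition p_integral :: "nat \<Rightarrow> rat \<Rightarrow> bool" where
  "p_integral p x \<longleftrightarrow> coprime (snd (quotient_of x)) (int p)"

definition rat_cong_pow :: "nat \<Rightarrow> nat \<Rightarrow> rat \<Rightarrow> rat \<Rightarrow> bool" where
  "rat_cong_pow p m a b \<longleftrightarrow> p_integral p ((a - b) / of_nat p ^ m)"

definition fermat_quotient :: "nat \<Rightarrow> rat \<Rightarrow> rat" where
  "fermat_quotient p a = (a ^ (p - 1) - 1) / of_nat p"

text \<open>The exponential generating function of the Euler numbers, \<open>2 / (e\<^sup>x + e\<^sup>-\<^sup>x)\<close>.\<close>

definition euler_egf :: "rat fps" where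
  "euler_egf = 2 / (fps_exp 1 + fps_exp (- 1))"

definition euler_number :: "nat \<Rightarrow> rat" where
  "euler_number n = fact n * fps_nth euler_egf n"

text \<open>Division of formal power series is total, so we check that the quotient is a genuine one.\<close>

lemma euler_egf_mult: "euler_egf * (fps_exp 1 + fps_exp (- 1)) = 2"
proof -
  have "fps_nth (fps_exp 1 + fps_exp (- 1) :: rat fps) 0 \<noteq> 0"
    by simp
  then show ?thesis
    unfolding euler_egf_def by (simp add: fps_divide_unit inverse_mult_eq_1 mult.assoc)
qed

end

theory Submission
  imports Defs
begin

text \<open>
  Put \<open>n = (p - 1) / 2\<close>. A WZ pair turns the partial sum up to \<open>n - 1\<close> into the finite sum of
  \<open>F(n, k)\<close> over \<open>1 \<le> k \<le> n\<close>, where \<open>F\<close> is a product of factorials and Pochhammer symbols.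
  For \<open>k \<le> n - 2\<close> the term \<open>F(n, k)\<close> is divisible by \<open>p\<^sup>2\<close>; with \<open>j = n - k\<close> its quotient by
  \<open>p\<^sup>2\<close> is, modulo \<open>p\<^sup>2\<close>, \<open>(-1)\<^sup>j\<close> times a rational function of \<open>j\<close> plus \<open>p\<close> times a
  harmonic correction. The sum over \<open>j\<close> telescopes up to the harmonic number \<open>H\<^sub>n\<close>, which is
  \<open>- 2 q\<^sub>p(2)\<close> modulo \<open>p\<close>, and the sum of \<open>(-1)\<^sup>j / j\<^sup>2\<close>, which is \<open>2 (-1)\<^sup>n E\<^bsub>p-3\<^esub>\<close> modulo \<open>p\<close>.
  The two terms \<open>k = n - 1\<close> and \<open>k = n\<close> are divisible only by \<open>p\<close>; their sum is an explicit
  rational function of \<open>p\<close> modulo \<open>p\<^sup>4\<close> by a Wolstenholme-type congruence.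
\<close>

section \<open>The WZ pair\<close>

definition summand :: "nat \<Rightarrow> rat" where
  "summand k = (92 * of_nat k ^ 2 + 61 * of_nat k + 9) / ((2 * of_nat k + 1) * 64 ^ k)
     * of_nat ((2 * k) choose k) * of_nat ((3 * k) choose k) * of_nat ((4 * k) choose (2 * k))"

text \<open>In Gamma-function terms \<open>1 / fact (N - k) ^ 2\<close> vanishes for
  \<open>k > N\<close>, which makes the sum over \<open>k\<close> finite. With truncated subtraction
  this is lost, so the formula is used only for \<open>1 \<le> k \<le> N\<close>.\<close>

definition wz_F :: "nat \<Rightarrow> nat \<Rightarrow> rat" where
  "wz_F N k = - 6 * (2 * of_nat N + 1 - 4 * of_nat k) * fact (3 * N - k - 1)
     * pochhammer (1/2) (2 * N + k - 1) * pochhammer (1/2) N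
     / (fact (N - k) ^ 2 * pochhammer (1/2) k ^ 2 * fact (2 * N - 1) ^ 2)"

text \<open>
  The cubic in \<open>k\<close> is the solution of the linear system that \<open>F(N+1,k) - F(N,k) = G(N,k+1) - G(N,k)\<close>
  imposes on its coefficients. No subtraction below is truncated when \<open>1 \<le> k \<le> N\<close>.
\<close>

definition wz_G :: "nat \<Rightarrow> nat \<Rightarrow> rat" where
  "wz_G N k = (- (39 * of_nat N + 303 * of_nat N ^ 2 + 726 * of_nat N ^ 3 + 552 * of_nat N ^ 4)
       + (84 * of_nat N ^ 3 + 18 * of_nat N ^ 2 - 42 * of_nat N - 15) * of_nat k
       + (48 * of_nat N ^ 2 + 66 * of_nat N + 21) * of_nat k ^ 2 - (12 * of_nat N + 6) * of_nat k ^ 3)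
     * fact (3 * N - k) * pochhammer (1/2) (2 * N + k - 1) * pochhammer (1/2) N
     / (fact (N + 1 - k) ^ 2 * pochhammer (1/2) (k - 1) ^ 2 * fact (2 * N + 1) ^ 2)"

lemma pochhammer_half_pos: "pochhammer (1/2 :: rat) n > 0"
  by (rule pochhammer_pos) simp

lemma pochhammer_half_eq_fact: "pochhammer (1/2 :: rat) n = fact (2 * n) / (4 ^ n * fact n)"
proof -
  have "(4 :: rat) ^ n = 2 ^ (2 * n)" by (simp add: power_mult)
  thus ?thesis using fact_double[of n, where 'a=rat] by (simp add: field_simps)
qed

text \<open>All four terms are polynomial multiples of one hypergeometric term, so the claim reduces
  to a polynomial identity. Writing \<open>k = i + 1\<close> and \<open>N = i + 1 + m\<close>
  removes every natural subtraction.\<close>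

lemma wz_pair:
  assumes "1 \<le> k" "k \<le> N"
  shows "wz_F (Suc N) k - wz_F N k = wz_G N (Suc k) - wz_G N k"
proof -
  obtain i where k: "k = Suc i" using assms by (cases k) auto
  obtain m where N: "N = Suc i + m" using assms k by (metis le_Suc_ex)
  define a b h where "a = 2 * i + 3 * m + 1" and "b = 3 * i + 2 * m + 2" and "h = 2 * i + 2 * m + 1"
  define x y :: rat where "x = of_nat i" and "y = of_nat m"
  have xy: "x \<ge> 0" "y \<ge> 0" by (simp_all add: x_def y_def)
  have ix: "3 * N - k - 1 = a" "3 * N - k = Suc a"
     "3 * Suc N - k - 1 = Suc (Suc (Suc a))" "3 * N - Suc k = a"
     "2 * N + k - 1 = b" "2 * N + Suc k - 1 = Suc b" "2 * Suc N + k - 1 = Suc (Suc b)"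
     "N - k = m" "Suc N - k = Suc m" "N + 1 - k = Suc m" "N + 1 - Suc k = m"
     "2 * N - 1 = h" "2 * Suc N - 1 = Suc (Suc h)"
     "2 * N + 1 = Suc (Suc h)" "k - 1 = i" "Suc k - 1 = Suc i"
    by (simp_all add: k N a_def b_def h_def)
  have of_nat: "rat_of_nat a = 2 * x + 3 * y + 1" "rat_of_nat b = 3 * x + 2 * y + 2"
      "rat_of_nat h = 2 * x + 2 * y + 1" "rat_of_nat N = x + y + 1" "rat_of_nat k = x + 1"
      "rat_of_nat i = x" "rat_of_nat m = y"
    by (simp_all add: a_def b_def h_def N k x_def y_def)
  define A B C D E H :: rat where "A = fact a" and "B = pochhammer (1/2) b"
     and "C = pochhammer (1/2) N" and "D = fact m" and "E = pochhammer (1/2) i" and "H = fact h"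
  note atoms = A_def[symmetric] B_def[symmetric] C_def[symmetric] D_def[symmetric]
     E_def[symmetric] H_def[symmetric]
  have "D \<noteq> 0" "E \<noteq> 0" "H \<noteq> 0"
    using pochhammer_half_pos[of i] by (simp_all add: D_def E_def H_def)
  moreover have "y + 1 \<noteq> 0" "1/2 + x \<noteq> 0" "2 * x + 2 * y + 2 \<noteq> 0" "2 * x + 2 * y + 3 \<noteq> 0"
    using xy by linarith+
  moreover define u v w w' where "u = y + 1" and "v = 1/2 + x"
    and "w = 2 * x + 2 * y + 2" and "w' = 2 * x + 2 * y + 3"
  ultimately have nz: "D \<noteq> 0" "E \<noteq> 0" "H \<noteq> 0" "u \<noteq> 0" "v \<noteq> 0" "w \<noteq> 0" "w' \<noteq> 0"
    by auto
  define a1 a2 a3 b1 b2 c1 where "a1 = 2 * x + 3 * y + 2" and "a2 = 2 * x + 3 * y + 3"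
    and "a3 = 2 * x + 3 * y + 4" and "b1 = 3 * x + 2 * y + 5/2" and "b2 = 3 * x + 2 * y + 7/2"
    and "c1 = x + y + 3/2"
  note ds = u_def v_def w_def w'_def a1_def a2_def a3_def b1_def b2_def c1_def
  have steps: "fact (Suc a) = a1 * A" "fact (Suc (Suc (Suc a))) = a3 * a2 * a1 * A"
    "pochhammer (1/2) (Suc b) = B * b1" "pochhammer (1/2) (Suc (Suc b)) = B * b1 * b2"
    "fact (Suc m) = u * D" "fact (Suc (Suc h)) = w' * w * H"
    "pochhammer (1/2) (Suc i) = E * v" "pochhammer (1/2) (Suc N) = C * c1"
    by (simp_all add: ds atoms of_nat pochhammer_Suc fact_Suc[of "Suc (Suc _)"] add_ac mult_ac)
  \<comment> \<open>The denominator collects the largest factorials and Pochhammer symbols among the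
    four terms, so that every cofactor of \<open>c\<close> is a polynomial.\<close>
  define c where "c = A * B * C / (D ^ 2 * u ^ 2 * (E * v) ^ 2 * (w' * w * H) ^ 2)"
  have F1: "wz_F N k = (- 6 * (2 * of_nat N + 1 - 4 * of_nat k) * u ^ 2 * (w * w') ^ 2) * c"
    unfolding wz_F_def ix c_def atoms using nz
    by (simp add: k steps atoms power_mult_distrib del: fact_Suc of_nat_Suc)
  have F2: "wz_F (Suc N) k = (- 6 * (2 * of_nat (Suc N) + 1 - 4 * of_nat k)
      * (a3 * a2 * a1) * (b1 * b2) * c1) * c"
    unfolding wz_F_def ix c_def atoms using nz
    by (simp add: steps atoms power_mult_distrib del: fact_Suc of_nat_Suc)
       (simp add: k steps power_mult_distrib mult_ac del: fact_Suc of_nat_Suc)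
  define P where "P = (\<lambda>n k::rat. - (39 * n + 303 * n ^ 2 + 726 * n ^ 3 + 552 * n ^ 4)
       + (84 * n ^ 3 + 18 * n ^ 2 - 42 * n - 15) * k
       + (48 * n ^ 2 + 66 * n + 21) * k ^ 2 - (12 * n + 6) * k ^ 3)"
  have G1: "wz_G N k = (P (of_nat N) (of_nat k) * a1 * v ^ 2) * c"
    unfolding wz_G_def ix c_def atoms steps P_def[symmetric] using nz
    by (simp add: power_mult_distrib P_def mult_ac)
  have G2: "wz_G N (Suc k) = (P (of_nat N) (of_nat (Suc k)) * b1 * u ^ 2) * c"
    unfolding wz_G_def ix c_def atoms steps P_def[symmetric] using nz
    by (simp add: power_mult_distrib P_def mult_ac del: of_nat_Suc)
  have "- 6 * (2 * of_nat (Suc N) + 1 - 4 * of_nat k) * (a3 * a2 * a1) * (b1 * b2) * c1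
      - (- 6 * (2 * of_nat N + 1 - 4 * of_nat k) * u ^ 2 * (w * w') ^ 2)
      = P (of_nat N) (of_nat (Suc k)) * b1 * u ^ 2 - P (of_nat N) (of_nat k) * a1 * v ^ 2"
    unfolding of_nat_Suc of_nat ds P_def
    by (simp add: algebra_simps add_divide_distrib diff_divide_distrib power2_eq_square power3_eq_cube power4_eq_xxxx)
  thus ?thesis unfolding F1 F2 G1 G2 left_diff_distrib[symmetric] by simp
qed

lemma summand_eq:
  "summand N = (92 * of_nat N ^ 2 + 61 * of_nat N + 9) * fact (4 * N) * fact (3 * N)
     / ((2 * of_nat N + 1) * 64 ^ N * fact N ^ 3 * fact (2 * N) ^ 2)"
proof -
  have "(2 * of_nat N + 1 :: rat) \<noteq> 0"
    by (metis of_nat_0_eq_iff of_nat_Suc of_nat_mult of_nat_numeral add.commute Suc_not_Zero)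
  thus ?thesis unfolding summand_def
    by (simp add: binomial_fact power2_eq_square power3_eq_cube) (simp add: mult_ac)
qed

text \<open>At \<open>k = 1\<close> the cubic factors as \<open>- (q * (3 * n) * d)\<close> with
  \<open>q = 92 * n ^ 2 + 61 * n + 9\<close> and \<open>d = 2 * n + 1\<close>. This is where the
  quadratic of the summand comes from.\<close>

lemma wz_G_1:
  assumes "N \<ge> 1"
  shows "wz_G N 1 = - summand N"
proof -
  obtain m where N: "N = Suc m" using assms by (cases N) auto
  define n :: rat where "n = of_nat N"
  have n: "n > 0" using assms by (simp add: n_def)
  have f3: "fact (3 * N) = 3 * n * (fact (3 * N - 1) :: rat)"
    by (simp add: n_def N numeral_3_eq_3)
  have f2: "fact (2 * N + 1) = (2 * n + 1) * (fact (2 * N) :: rat)"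
    by (simp add: n_def)
  have p: "(64::rat) ^ N = 4 ^ (2 * N) * 4 ^ N"
    by (simp add: power_mult power_mult_distrib[symmetric])
  define A B C :: rat where "A = fact (3 * N - 1)" and "B = fact (2 * N)" and "C = fact N"
  have "2 * n + 1 \<noteq> 0" using n by linarith
  hence nz: "2 * n + 1 \<noteq> 0" "n \<noteq> 0" "A \<noteq> 0" "B \<noteq> 0" "C \<noteq> 0" using n by (simp_all add: A_def B_def C_def)
  have e: "2 * (2 * N) = 4 * N" by simp
  define q d where "q = 92 * n ^ 2 + 61 * n + 9" and "d = 2 * n + 1"
  have P: "- (39 * n + 303 * n ^ 2 + 726 * n ^ 3 + 552 * n ^ 4)
       + (84 * n ^ 3 + 18 * n ^ 2 - 42 * n - 15) * of_nat 1
       + (48 * n ^ 2 + 66 * n + 21) * of_nat 1 ^ 2 - (12 * n + 6) * of_nat 1 ^ 3 = - (q * (3 * n) * d)"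
    unfolding q_def d_def
    by (simp add: algebra_simps add_divide_distrib diff_divide_distrib power2_eq_square power3_eq_cube power4_eq_xxxx)
  have d: "d \<noteq> 0" using nz by (simp add: d_def)
  have eqG: "wz_G N 1 = - (q * (3 * n) * d) * A * (fact (4 * N) / (4 ^ (2 * N) * B)) * (B / (4 ^ N * C))
      / (C ^ 2 * (d * B) ^ 2)"
    unfolding wz_G_def f2 n_def[symmetric] B_def[symmetric] P
    by (simp add: pochhammer_half_eq_fact e A_def B_def C_def d_def)
  have eqS: "summand N = q * fact (4 * N) * (3 * n * A) / (d * (4 ^ (2 * N) * 4 ^ N) * C ^ 3 * B ^ 2)"
    unfolding summand_eq f3 p by (simp add: n_def q_def d_def A_def B_def C_def)
  show ?thesis
    using nz d unfolding eqG eqS by (simp add: field_simps power2_eq_square power3_eq_cube)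
qed

text \<open>Induction on \<open>N\<close>: the WZ relation telescopes to
  \<open>wz_G N (Suc N) - wz_G N 1\<close>. The new diagonal term
  \<open>wz_F (Suc N) (Suc N)\<close> cancels the first of these, and the second contributes exactly
  \<open>summand N\<close>.\<close>

lemma sum_summand_eq_sum_wz_F:
  assumes "N \<ge> 1"
  shows "(\<Sum>k<N. summand k) = (\<Sum>k=1..N. wz_F N k)"
  using assms
proof (induction N rule: dec_induct)
  case base
  show ?case by (simp add: summand_def wz_F_def numeral_2_eq_2 pochhammer_Suc)
next
  case (step N)
  have top: "wz_F (Suc N) (Suc N) = - wz_G N (Suc N)"
  proof -
    define n :: rat where "n = of_nat N"
    have n: "n > 0" using step by (simp add: n_def)
    obtain m where N: "N = Suc m" using step by (cases N) auto
    have ix: "3 * Suc N - Suc N - 1 = 2 * N + 1" "2 * Suc N - 1 = 2 * N + 1"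
      "2 * Suc N + Suc N - 1 = Suc (Suc (3 * N))" "3 * N - Suc N = 2 * N - 1"
      "2 * N + Suc N - 1 = 3 * N" "N + 1 - Suc N = 0" "Suc N - Suc N = 0" "Suc N - 1 = N"
      by simp_all
    define A B C where "A = (fact (2 * N - 1) :: rat)" and "B = pochhammer (1/2 :: rat) (3 * N)"
      and "C = pochhammer (1/2 :: rat) N"
    define a b b' c where "a = (2 * n + 1) * (2 * n)" and "b = 3 * n + 1/2" and "b' = 3 * n + 3/2"
      and "c = n + 1/2"
    have st: "(fact (2 * N + 1) :: rat) = a * A" "pochhammer (1/2) (Suc N) = C * c"
       "pochhammer (1/2) (Suc (Suc (3 * N))) = B * b * b'"
      subgoal by (simp add: a_def A_def n_def N algebra_simps)
      subgoal by (simp add: c_def C_def n_def pochhammer_Suc add.commute)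
      subgoal by (simp add: b_def b'_def B_def n_def pochhammer_Suc add_ac)
      done
      have nz: "a > 0" "b > 0" "b' > 0" "c > 0" "A > 0" "C > 0" using n
      by (simp_all add: a_def b_def b'_def c_def A_def C_def pochhammer_half_pos)
    define P where "P = - (39 * n + 303 * n ^ 2 + 726 * n ^ 3 + 552 * n ^ 4)
       + (84 * n ^ 3 + 18 * n ^ 2 - 42 * n - 15) * (n + 1)
       + (48 * n ^ 2 + 66 * n + 21) * (n + 1) ^ 2 - (12 * n + 6) * (n + 1) ^ 3"
    have P: "P = - (12 * a * b * b')"
      unfolding P_def a_def b_def b'_def
      by (simp add: algebra_simps add_divide_distrib diff_divide_distrib power2_eq_square power3_eq_cube power4_eq_xxxx)
    have eqF: "wz_F (Suc N) (Suc N) = - 6 * (- 2 * c) * (a * A) * (B * b * b') * (C * c)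
        / ((C * c) ^ 2 * (a * A) ^ 2)"
      unfolding wz_F_def ix st by (simp add: c_def n_def)
    have eqG: "wz_G N (Suc N) = P * A * B * C / (C ^ 2 * (a * A) ^ 2)"
      unfolding wz_G_def ix st by (simp add: P_def n_def A_def B_def C_def add.commute)
    show ?thesis using nz unfolding eqF eqG P
      by (simp add: field_simps power2_eq_square)
  qed
  have "(\<Sum>k=1..N. wz_F (Suc N) k) - (\<Sum>k=1..N. wz_F N k)
      = (\<Sum>k=1..N. wz_G N (Suc k) - wz_G N k)"
    unfolding sum_subtractf[symmetric] by (intro sum.cong wz_pair) auto
  also have "\<dots> = wz_G N (Suc N) - wz_G N 1"
    using step by (subst sum_Suc_diff) auto
  finally show ?case using step top wz_G_1[of N] by simp
qed

section \<open>Congruences between p-integral rationals\<close>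

definition harmonic :: "nat \<Rightarrow> rat" where
  "harmonic m = (\<Sum>i=1..m. 1 / of_nat i)"

lemma harmonic_0 [simp]: "harmonic 0 = 0"
  and harmonic_Suc: "harmonic (Suc m) = harmonic m + 1 / of_nat (Suc m)"
  by (simp_all add: harmonic_def)

text \<open>The bound excludes \<open>p = 3\<close>, since below 3 is inverted modulo p and the
  exponent \<open>p - 3\<close> has to be positive.\<close>

locale prime_gt_3 =
  fixes p n :: nat
  assumes prime: "prime p" and p_eq: "p = 2 * n + 1" and n_ge: "n \<ge> 2"
begin

abbreviation "P \<equiv> rat_of_nat p"
abbreviation "pint \<equiv> p_integral p"
abbreviation cong_pow :: "rat \<Rightarrow> rat \<Rightarrow> nat \<Rightarrow> bool" (\<open>(\<open>notation=\<open>mixfix cong_pow\<close>\<close>[_ \<doteq> _]'(_'))\<close>)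
  where "[a \<doteq> b](m) \<equiv> rat_cong_pow p m a b"

lemma P_eq: "P = 2 * of_nat n + 1" by (simp add: p_eq)

lemma P_pos [simp]: "P > 0" using p_eq by simp

lemma P_nz [simp]: "p \<noteq> 0" using p_eq by simp

lemma p_gt3: "p > 3" using p_eq n_ge by simp

section \<open>Closure properties of p-integral rationals\<close>

lemma pint_divide_int:
  assumes "coprime b (int p)"
  shows "pint (of_int a / of_int b)"
proof -
  have b: "b \<noteq> 0" using assms n_ge by (auto simp: p_eq)
  obtain c d where q: "quotient_of (of_int a / of_int b) = (c, d)" by force
  have d: "d > 0" "coprime c d" using q quotient_of_denom_pos quotient_of_coprime by blast+
  have "of_int a / of_int b = (of_int c / of_int d :: rat)" using q quotient_of_div by blast
  hence "rat_of_int (a * d) = of_int (c * b)" using b d by (simp add: field_simps)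
  hence "a * d = c * b" using of_int_eq_iff by blast
  \<comment> \<open>The reduced denominator \<open>d\<close> is coprime to \<open>c\<close>, hence
    divides any other denominator \<open>b\<close> of the same fraction.\<close>
  hence "d dvd b" using d by (metis coprime_commute coprime_dvd_mult_right_iff dvd_triv_right)
  hence "coprime d (int p)" using coprime_divisors[of d b "int p" "int p"] assms by simp
  thus ?thesis by (simp add: p_integral_def q)
qed

lemma pintE:
  assumes "pint x" obtains a b where "coprime b (int p)" "b > 0" "x = of_int a / of_int b"
proof -
  obtain c d where q: "quotient_of x = (c, d)" by force
  thus ?thesis using that[of d c] assms quotient_of_div[OF q] quotient_of_denom_pos[OF q]
    by (simp add: p_integral_def)
qed

lemma pint_of_int [simp]: "pint (of_int a)"
  using pint_divide_int[of 1 a] by simp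

lemma pint_of_nat [simp]: "pint (of_nat a)"
  using pint_of_int[of "int a"] by simp

lemma pint_numeral [simp]: "pint (numeral k)"
  using pint_of_int[of "numeral k"] by simp

lemma pint_0 [simp]: "pint 0" and pint_1 [simp]: "pint 1"
  using pint_of_int[of 0] pint_of_int[of 1] by simp_all

lemma pint_add: assumes "pint x" "pint y" shows "pint (x + y)"
proof -
  obtain a b where x: "coprime b (int p)" "b > 0" "x = of_int a / of_int b" using pintE[OF assms(1)] .
  obtain c d where y: "coprime d (int p)" "d > 0" "y = of_int c / of_int d" using pintE[OF assms(2)] .
  have eq: "x + y = of_int (a * d + c * b) / of_int (b * d)" using x y by (simp add: field_simps)
  show ?thesis unfolding eq using x(1) y(1) by (intro pint_divide_int) simp
qed

lemma pint_mult: assumes "pint x" "pint y" shows "pint (x * y)"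
proof -
  obtain a b where x: "coprime b (int p)" "b > 0" "x = of_int a / of_int b" using pintE[OF assms(1)] .
  obtain c d where y: "coprime d (int p)" "d > 0" "y = of_int c / of_int d" using pintE[OF assms(2)] .
  have eq: "x * y = of_int (a * c) / of_int (b * d)" using x y by (simp add: field_simps)
  show ?thesis unfolding eq using x(1) y(1) by (intro pint_divide_int) simp
qed

lemma pint_minus: assumes "pint x" shows "pint (- x)"
  using pint_mult[OF pint_of_int[of "-1"] assms] by simp

lemma pint_diff: assumes "pint x" "pint y" shows "pint (x - y)"
  using pint_add[OF assms(1) pint_minus[OF assms(2)]] by simp

lemma pint_power: "pint x \<Longrightarrow> pint (x ^ k)"
  by (induction k) (auto intro: pint_mult)

lemma pint_minus_one_power [simp]: "pint ((- 1) ^ k)"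
  by (intro pint_power pint_minus pint_1)

lemma pint_sum: "(\<And>i. i \<in> A \<Longrightarrow> pint (f i)) \<Longrightarrow> pint (sum f A)"
  by (induction A rule: infinite_finite_induct) (auto intro: pint_add)

lemmas pint_intros = pint_add pint_mult pint_minus pint_diff pint_power

lemma coprime_small: "0 < k \<Longrightarrow> k < p \<Longrightarrow> coprime k p"
  using prime_imp_coprime_nat[OF prime, of k] nat_dvd_not_less[of k p] by (simp add: coprime_commute)

lemma pint_inverse_int: "coprime k (int p) \<Longrightarrow> pint (1 / of_int k)"
  using pint_divide_int[of k 1] by simp

lemma pint_inverse_nat: "coprime k p \<Longrightarrow> pint (1 / of_nat k)"
  using pint_inverse_int[of "int k"] by simp

lemma pint_inverse_small: "k < p \<Longrightarrow> pint (1 / of_nat k)"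
  by (cases "k = 0") (auto intro: pint_inverse_nat coprime_small)

lemma pint_divide: "pint x \<Longrightarrow> pint (1 / y) \<Longrightarrow> pint (x / y)"
  using pint_mult[of x "1 / y"] by simp

lemma pint_inverse_mult: "pint (1 / x) \<Longrightarrow> pint (1 / y) \<Longrightarrow> pint (1 / (x * y))"
  using pint_mult[of "1 / x" "1 / y"] by simp

lemma pint_inverse_power: "pint (1 / x) \<Longrightarrow> pint (1 / x ^ k)"
  using pint_power[of "1 / x" k] by (simp add: power_divide)

lemma pint_harmonic: "m < p \<Longrightarrow> pint (harmonic m)"
  unfolding harmonic_def by (intro pint_sum pint_inverse_small) auto

section \<open>Calculus of congruences modulo powers of p\<close>

lemma cong_iff: "[a \<doteq> b](m) \<longleftrightarrow> (\<exists>z. pint z \<and> a = b + P ^ m * z)"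
proof
  assume "[a \<doteq> b](m)"
  thus "\<exists>z. pint z \<and> a = b + P ^ m * z"
    by (intro exI[of _ "(a - b) / P ^ m"]) (simp add: rat_cong_pow_def)
qed (auto simp: rat_cong_pow_def)

text \<open>The working form of a congruence: \<open>z\<close> is the exact error divided by the
  power of p. Expansions below are proved by exhibiting it.\<close>

lemma congI: "pint z \<Longrightarrow> a = b + P ^ m * z \<Longrightarrow> [a \<doteq> b](m)"
  using cong_iff by blast

lemma congE: assumes "[a \<doteq> b](m)" obtains z where "pint z" "a = b + P ^ m * z"
  using assms cong_iff by blast

lemma cong_refl [simp]: "[a \<doteq> a](m)"
  by (rule congI[of 0]) simp_all

lemma cong_sym: assumes "[a \<doteq> b](m)" shows "[b \<doteq> a](m)"
proof -
  from assms obtain z where "pint z" "a = b + P ^ m * z" by (rule congE)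
  thus ?thesis by (intro congI[of "- z"]) (auto intro: pint_minus)
qed

lemma cong_add: assumes "[a \<doteq> b](m)" "[c \<doteq> d](m)" shows "[a + c \<doteq> b + d](m)"
proof -
  from assms(1) obtain z where "pint z" "a = b + P ^ m * z" by (rule congE)
  moreover from assms(2) obtain w where "pint w" "c = d + P ^ m * w" by (rule congE)
  ultimately show ?thesis by (intro congI[of "z + w"]) (auto intro: pint_add simp: algebra_simps)
qed

lemma cong_minus: assumes "[a \<doteq> b](m)" shows "[- a \<doteq> - b](m)"
  using cong_sym[OF assms] by (simp add: rat_cong_pow_def)

lemma cong_diff: assumes "[a \<doteq> b](m)" "[c \<doteq> d](m)" shows "[a - c \<doteq> b - d](m)"
  using cong_add[OF assms(1) cong_minus[OF assms(2)]] by simp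

lemma cong_trans [trans]: assumes "[a \<doteq> b](m)" "[b \<doteq> c](m)" shows "[a \<doteq> c](m)"
  using cong_add[OF assms] by (simp add: rat_cong_pow_def)

lemma cong_cmult: assumes "pint c" "[a \<doteq> b](m)" shows "[c * a \<doteq> c * b](m)"
proof -
  from assms(2) obtain z where "pint z" "a = b + P ^ m * z" by (rule congE)
  thus ?thesis using assms(1) by (intro congI[of "c * z"]) (auto intro: pint_mult simp: algebra_simps)
qed

text \<open>The path from \<open>a * c\<close> via \<open>a * d\<close> to \<open>b * d\<close>
  multiplies only by \<open>a\<close> and \<open>d\<close>, so only these two have to be
  p-integral.\<close>

lemma cong_mult:
  assumes "[a \<doteq> b](m)" "[c \<doteq> d](m)" "pint a" "pint d" shows "[a * c \<doteq> b * d](m)"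
  using cong_trans[OF cong_cmult[OF assms(3,2)]] cong_cmult[OF assms(4,1)] by (simp add: mult.commute)

lemma cong_sum: "(\<And>i. i \<in> A \<Longrightarrow> [f i \<doteq> g i](m)) \<Longrightarrow> [sum f A \<doteq> sum g A](m)"
  by (induction A rule: infinite_finite_induct) (auto intro: cong_add)

text \<open>An explicit factor \<open>P ^ k\<close> raises the modulus; hence terms divisible by p^2
  need to be expanded modulo p^2 only.\<close>

lemma cong_scale: assumes "[a \<doteq> b](m)" shows "[P ^ k * a \<doteq> P ^ k * b](k + m)"
proof -
  from assms obtain z where "pint z" "a = b + P ^ m * z" by (rule congE)
  thus ?thesis by (intro congI[of z]) (auto simp: algebra_simps power_add)
qed

lemma cong_weaken: assumes "[a \<doteq> b](m)" "k \<le> m" shows "[a \<doteq> b](k)"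
proof -
  obtain z where z: "pint z" "a = b + P ^ m * z" using assms(1) congE by blast
  have "P ^ m = P ^ k * P ^ (m - k)" using assms(2) by (simp flip: power_add)
  hence "a = b + P ^ k * (P ^ (m - k) * z)" using z by (simp add: mult.assoc)
  thus ?thesis using z by (intro congI[of "P ^ (m - k) * z"]) (auto intro!: pint_intros)
qed

lemma cong_pint: assumes "[a \<doteq> b](m)" "pint b" shows "pint a"
  using assms by (elim congE) (auto intro!: pint_intros)

lemma cong_divide: "pint (1 / c) \<Longrightarrow> [a \<doteq> b](m) \<Longrightarrow> [a / c \<doteq> b / c](m)"
  using cong_cmult[of "1 / c" m a b] by simp

lemma cong_of_nat: assumes "[a = b] (mod p)" shows "[of_nat a \<doteq> of_nat b](1)"
proof -
  have "[int b = int a] (mod int p)" using assms by (simp add: cong_int_iff cong_sym_eq)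
  then obtain c where "int a = int b + int p * c" by (auto simp: cong_iff_lin)
  hence "rat_of_int (int a) = of_int (int b + int p * c)" by simp
  hence "rat_of_nat a = of_nat b + P * of_int c" by simp
  thus ?thesis by (intro congI[of "of_int c"]) simp_all
qed

text \<open>The product of the \<open>i + P * c\<close> is expanded to first order in p; the linear
  coefficient is the sum of the reciprocals \<open>1 / i\<close>.\<close>

lemma pochhammer_cong:
  assumes "pint c" "m < p"
  shows "[pochhammer (1 + P * c) m \<doteq> fact m * (1 + P * c * harmonic m)](2)"
  using assms(2)
proof (induction m)
  case (Suc m)
  define x where "x = rat_of_nat m + 1"
  have x: "x \<noteq> 0" "of_nat (Suc m) = x"
    unfolding x_def by (metis add.commute of_nat_Suc of_nat_eq_0_iff Suc_not_Zero, simp)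
  have "pint (x + P * c)" unfolding x_def using assms by (intro pint_add pint_mult) simp_all
  moreover have "[pochhammer (1 + P * c) m \<doteq> fact m * (1 + P * c * harmonic m)](2)"
    using Suc by simp
  ultimately have "[(x + P * c) * pochhammer (1 + P * c) m \<doteq>
     (x + P * c) * (fact m * (1 + P * c * harmonic m))](2)"
    by (rule cong_cmult)
  also have "[(x + P * c) * (fact m * (1 + P * c * harmonic m)) \<doteq>
     fact (Suc m) * (1 + P * c * harmonic (Suc m))](2)"
  proof (rule congI)
    \<comment> \<open>The witness is the only second-order term: the new correction
      \<open>P * c\<close> times the old one \<open>P * c * harmonic m\<close>.\<close>
    have "pint (fact m)" using pint_of_nat[of "fact m"] by simp
    thus "pint (fact m * c ^ 2 * harmonic m)"
      using Suc.prems assms(1) by (intro pint_mult pint_power pint_harmonic) simp_all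
    have "fact (Suc m) = x * fact m" by (simp add: x_def)
    thus "(x + P * c) * (fact m * (1 + P * c * harmonic m)) =
       fact (Suc m) * (1 + P * c * harmonic (Suc m)) + P ^ 2 * (fact m * c ^ 2 * harmonic m)"
      unfolding harmonic_Suc x(2) using x(1) by (simp add: field_simps power2_eq_square)
  qed
  finally show ?case by (simp add: pochhammer_Suc x_def add_ac mult_ac)
qed simp

end

section \<open>Harmonic sums and Pochhammer symbols modulo powers of p\<close>

text \<open>For \<open>p = 2 * m + 1\<close> the partner of \<open>j\<close> is
  \<open>p - j\<close>.\<close>

lemma sum_pair_reflect:
  fixes f :: "nat \<Rightarrow> 'a :: comm_monoid_add"
  shows "(\<Sum>i=1..2*m. f i) = (\<Sum>j=1..m. f j + f (2 * m + 1 - j))"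
proof -
  have "(\<Sum>i=1..2*m. f i) = (\<Sum>i=1..m. f i) + (\<Sum>i=1+m..m+m. f i)"
    using sum.ub_add_nat[of 1 m f m] by (simp add: mult_2)
  also have "(\<Sum>i=1+m..m+m. f i) = (\<Sum>i=1..m. f (i + m))"
    by (rule sum.shift_bounds_cl_nat_ivl)
  also have "\<dots> = (\<Sum>i=1..m. f (2 * m + 1 - i))"
    by (subst sum.atLeastAtMost_rev) (intro sum.cong, auto intro: arg_cong[where f = f])
  finally show ?thesis by (simp add: sum.distrib)
qed

lemma prod_pair_reflect:
  fixes f :: "nat \<Rightarrow> 'a :: comm_monoid_mult"
  shows "(\<Prod>i=1..2*m. f i) = (\<Prod>j=1..m. f j * f (2 * m + 1 - j))"
proof -
  have "(\<Prod>i=1..2*m. f i) = (\<Prod>i=1..m. f i) * (\<Prod>i=1+m..m+m. f i)"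
    using prod.ub_add_nat[of 1 m f m] by (simp add: mult_2)
  also have "(\<Prod>i=1+m..m+m. f i) = (\<Prod>i=1..m. f (i + m))"
    by (rule prod.shift_bounds_cl_nat_ivl)
  also have "\<dots> = (\<Prod>i=1..m. f (2 * m + 1 - i))"
    by (subst prod.atLeastAtMost_rev) (intro prod.cong, auto intro: arg_cong[where f = f])
  finally show ?thesis by (simp add: prod.distrib)
qed

text \<open>For \<open>p = 2 * m + 1\<close> the even index \<open>2 * j\<close> meets the odd index
  \<open>p - 2 * j\<close>, so reflection modulo p turns both into terms in
  \<open>2 * j\<close>.\<close>

lemma sum_pair_parity:
  fixes f :: "nat \<Rightarrow> 'a :: comm_monoid_add"
  shows "(\<Sum>i=1..2*m. f i) = (\<Sum>j=1..m. f (2 * j) + f (2 * (m + 1 - j) - 1))"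
proof -
  have "(\<Sum>i=1..2*m. f i) = (\<Sum>j=1..m. f (2 * j)) + (\<Sum>j=1..m. f (2 * j - 1))"
    by (induction m) (simp_all add: add_ac)
  also have "(\<Sum>j=1..m. f (2 * j - 1)) = (\<Sum>j=1..m. f (2 * (m + 1 - j) - 1))"
    by (subst sum.atLeastAtMost_rev) (simp add: add.commute)
  finally show ?thesis by (simp add: sum.distrib)
qed

context prime_gt_3
begin

section \<open>Reflection and harmonic sums modulo p\<close>

lemma inverse_reflect:
  assumes "0 < i" "i < p"
  shows "[1 / of_nat (p - i) \<doteq> - (1 / of_nat i)](1)"
proof (rule congI)
  have "pint (1 / of_nat (i * (p - i)))"
    unfolding of_nat_mult using assms by (intro pint_inverse_mult pint_inverse_small) auto
  thus "pint (1 / (of_nat i * of_nat (p - i)))" by simp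
  have "rat_of_nat (p - i) = P - of_nat i" "P - of_nat i \<noteq> 0" "rat_of_nat i \<noteq> 0"
    using assms by (auto simp: of_nat_diff)
  thus "1 / of_nat (p - i) = - (1 / of_nat i) + P ^ 1 * (1 / (of_nat i * of_nat (p - i)))"
    by (simp add: field_simps)
qed

lemma harmonic_p_minus_1: "[harmonic (2 * n) \<doteq> 0](1)"
proof -
  have "harmonic (2 * n) = (\<Sum>j=1..n. 1 / of_nat j + 1 / of_nat (p - j))"
    unfolding harmonic_def by (subst sum_pair_reflect) (simp add: p_eq)
  also have "[\<dots> \<doteq> (\<Sum>j=1..n. 1 / of_nat j + - (1 / of_nat j))](1)"
    by (intro cong_sum cong_add cong_refl inverse_reflect) (auto simp: p_eq)
  finally show ?thesis by simp
qed

text \<open>Each step removes the top term \<open>1 / of_nat (p - Suc m)\<close>, which is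
  \<open>- (1 / of_nat (Suc m))\<close> modulo p.\<close>

lemma harmonic_reflect: "m \<le> 2 * n \<Longrightarrow> [harmonic (2 * n - m) \<doteq> harmonic m](1)"
proof (induction m)
  case 0
  show ?case using harmonic_p_minus_1 by simp
next
  case (Suc m)
  have "2 * n - m = Suc (2 * n - Suc m)" using Suc.prems by simp
  hence "harmonic (2 * n - Suc m) = harmonic (2 * n - m) - 1 / of_nat (2 * n - m)"
    using harmonic_Suc[of "2 * n - Suc m"] by simp
  also have "\<dots> = harmonic (2 * n - m) - 1 / of_nat (p - Suc m)"
    by (simp add: p_eq)
  also have "[\<dots> \<doteq> harmonic m - - (1 / of_nat (Suc m))](1)"
    using Suc by (intro cong_diff inverse_reflect) (auto simp: p_eq)
  finally show ?case by (simp add: harmonic_Suc)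
qed

text \<open>The sum of \<open>1 / i^2\<close> over \<open>1..p-1\<close> is evaluated twice: pairing
  \<open>i\<close> with \<open>p - i\<close> gives \<open>2 * T\<close>, pairing by parity gives
  \<open>T / 2\<close>. Hence \<open>3/2 * T\<close> vanishes modulo p, and 3 is invertible.\<close>

lemma sum_inverse_squares: "[(\<Sum>j=1..n. 1 / rat_of_nat j ^ 2) \<doteq> 0](1)"
proof -
  define T where "T = (\<Sum>j=1..n. 1 / rat_of_nat j ^ 2)"
  have sq: "[1 / rat_of_nat (p - i) ^ 2 \<doteq> 1 / of_nat i ^ 2](1)" if "0 < i" "i < p" for i
  proof -
    have "[(1 / of_nat (p - i)) * (1 / of_nat (p - i)) \<doteq> - (1 / of_nat i) * - (1 / of_nat i)](1)"
      using that by (intro cong_mult inverse_reflect pint_minus pint_inverse_small) auto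
    thus ?thesis by (simp add: power2_eq_square)
  qed
  have "(\<Sum>i=1..2*n. 1 / rat_of_nat i ^ 2) = (\<Sum>j=1..n. 1 / of_nat j ^ 2 + 1 / of_nat (p - j) ^ 2)"
    by (subst sum_pair_reflect) (simp add: p_eq)
  also have "[\<dots> \<doteq> (\<Sum>j=1..n. 1 / of_nat j ^ 2 + 1 / of_nat j ^ 2)](1)"
    by (intro cong_sum cong_add cong_refl sq) (auto simp: p_eq)
  finally have 1: "[(\<Sum>i=1..2*n. 1 / rat_of_nat i ^ 2) \<doteq> 2 * T](1)"
    by (simp add: T_def sum_distrib_left)
  have "(\<Sum>i=1..2*n. 1 / rat_of_nat i ^ 2) =
      (\<Sum>j=1..n. 1 / of_nat (2 * j) ^ 2 + 1 / of_nat (p - 2 * j) ^ 2)"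
    by (subst sum_pair_parity) (auto simp: p_eq intro!: sum.cong)
  also have "[\<dots> \<doteq> (\<Sum>j=1..n. 1 / of_nat (2 * j) ^ 2 + 1 / of_nat (2 * j) ^ 2)](1)"
    by (intro cong_sum cong_add cong_refl sq) (auto simp: p_eq)
  also have "\<dots> = 1 / 2 * T"
    by (simp add: T_def sum_distrib_left power_mult_distrib)
  finally have "[2 * T \<doteq> 1 / 2 * T](1)"
    by (rule cong_trans[OF cong_sym[OF 1]])
  hence "[2 * T - 1 / 2 * T \<doteq> 1 / 2 * T - 1 / 2 * T](1)" by (intro cong_diff cong_refl)
  hence "[(2/3) * (3/2 * T) \<doteq> (2/3) * 0](1)"
    using p_gt3 pint_inverse_small[of 3] by (intro cong_cmult) (auto intro: pint_divide)
  thus ?thesis by (simp add: T_def)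
qed

section \<open>Pochhammer symbols near 1/2 and 1\<close>

lemma pochhammer_pint: "pint a \<Longrightarrow> pint (pochhammer a m)"
  by (induction m) (auto simp: pochhammer_Suc intro!: pint_mult pint_add)

lemma pint_half: "pint (1/2)"
  using pint_inverse_small[of 2] p_gt3 by simp

text \<open>The factors are halves of the odd numbers up to \<open>2 * m - 1\<close>, which stay
  below p for \<open>m \<le> n\<close>; the next factor after \<open>m = n\<close> would be
  \<open>P/2\<close>.\<close>

lemma pint_inverse_pochhammer_half:
  assumes "m \<le> n" shows "pint (1 / pochhammer (1/2) m)"
  using assms
proof (induction m)
  case (Suc m)
  have e: "1 / (1/2 + rat_of_nat m) = 2 * (1 / of_nat (2 * m + 1))"
    by (simp add: divide_simps)
  have "pint (1 / (1/2 + rat_of_nat m))"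
    unfolding e using Suc.prems by (intro pint_mult pint_inverse_small pint_numeral) (auto simp: p_eq)
  thus ?case using Suc by (simp only: pochhammer_Suc) (intro pint_inverse_mult, auto)
qed simp

text \<open>Corresponding factors multiply to \<open>x ^ 2 - P ^ 2 / 4\<close>, so shifting
  symmetrically by \<open>P/2\<close> has no first-order effect.\<close>

lemma pochhammer_symmetric_cong:
  "[pochhammer (1/2 + P/2) m * pochhammer (1/2 - P/2) m \<doteq> pochhammer (1/2) m ^ 2](2)"
proof (induction m)
  case (Suc m)
  define x where "x = 1/2 + rat_of_nat m"
  have "pint x" using pint_half by (auto simp: x_def intro: pint_add)
  have "[x ^ 2 - P ^ 2 / 4 \<doteq> x ^ 2](2)"
    by (rule congI[of "- (1 / 2 * (1 / 2))"]) (intro pint_minus pint_mult pint_half, simp)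
  hence "[(pochhammer (1/2 + P/2) m * pochhammer (1/2 - P/2) m) * (x ^ 2 - P ^ 2 / 4)
      \<doteq> pochhammer (1/2) m ^ 2 * x ^ 2](2)"
    using \<open>pint x\<close> pint_half pint_mult[OF pint_half pint_of_nat[of p]]
    by (intro cong_mult Suc.IH) (auto intro!: pint_mult pochhammer_pint pint_add pint_diff pint_power)
  thus ?case by (simp add: pochhammer_Suc x_def power2_eq_square algebra_simps)
qed simp

text \<open>Products of two corrections carry p^4 and are invisible modulo p^3.\<close>

lemma prod_one_plus_cong:
  assumes "\<And>i. i \<in> A \<Longrightarrow> pint (c i)"
  shows "[(\<Prod>i\<in>A. 1 + P ^ 2 * c i) \<doteq> 1 + P ^ 2 * sum c A](3)"
  using assms
proof (induction A rule: infinite_finite_induct)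
  case (insert i A)
  have "[(1 + P ^ 2 * c i) * (\<Prod>i\<in>A. 1 + P ^ 2 * c i) \<doteq> (1 + P ^ 2 * c i) * (1 + P ^ 2 * sum c A)](3)"
    using insert by (intro cong_cmult) (auto intro!: pint_intros)
  also have "[(1 + P ^ 2 * c i) * (1 + P ^ 2 * sum c A) \<doteq> 1 + P ^ 2 * (c i + sum c A)](3)"
    using insert by (intro congI[of "P * c i * sum c A"])
      (auto intro!: pint_mult pint_sum simp: algebra_simps power2_eq_square power3_eq_cube)
  finally show ?case using insert by simp
qed simp_all

text \<open>Pairing \<open>i\<close> with \<open>p - i\<close> removes the linear term in \<open>p\<close>, and
  \<open>sum_inverse_squares\<close> the quadratic one.\<close>

lemma pochhammer_half_shift_cong: "[pochhammer (1 + P/2) (2 * n) \<doteq> fact (2 * n)](3)"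
proof -
  \<comment> \<open>Since \<open>j\<close> and \<open>p - j\<close> add up to p, the product of
    \<open>P/2 + j\<close> and \<open>P/2 + (p - j)\<close> is
    \<open>j * (p - j) + 3/4 * P ^ 2\<close>.\<close>
  define c :: "nat \<Rightarrow> rat" where "c j = 3/4 * (1 / (of_nat j * of_nat (p - j)))" for j
  have c: "pint (c j)" if "j \<in> {1..n}" for j
  proof -
    have "pint (3 * (1/2 * (1/2)))" by (intro pint_mult pint_half) simp
    thus ?thesis unfolding c_def
      using that by (intro pint_mult pint_inverse_mult pint_inverse_small) (auto simp: p_eq)
  qed
  have "pochhammer (1 + P/2) (2 * n) = (\<Prod>i=1..2*n. P/2 + of_nat i)"
    unfolding pochhammer_prod
    by (rule prod.reindex_bij_witness[of _ "\<lambda>i. i - 1" Suc]) (auto simp: algebra_simps)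
  also have "\<dots> = (\<Prod>j=1..n. (P/2 + of_nat j) * (P/2 + of_nat (p - j)))"
    by (subst prod_pair_reflect) (simp add: p_eq)
  also have "\<dots> = (\<Prod>j=1..n. (of_nat j * of_nat (p - j)) * (1 + P ^ 2 * c j))"
  proof (rule prod.cong)
    fix j assume j: "j \<in> {1..n}"
    have "rat_of_nat (p - j) = P - of_nat j" "P - of_nat j \<noteq> 0" "rat_of_nat j \<noteq> 0"
      using j by (auto simp: of_nat_diff p_eq)
    thus "(P/2 + of_nat j) * (P/2 + of_nat (p - j)) = (of_nat j * of_nat (p - j)) * (1 + P ^ 2 * c j)"
      unfolding c_def by (simp add: field_simps power2_eq_square)
  qed simp
  also have "\<dots> = fact (2 * n) * (\<Prod>j=1..n. 1 + P ^ 2 * c j)"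
  proof -
    have "fact (2 * n) = (\<Prod>i=1..2*n. rat_of_nat i)" by (simp add: fact_prod)
    also have "\<dots> = (\<Prod>j=1..n. of_nat j * of_nat (p - j))"
      by (subst prod_pair_reflect) (simp add: p_eq)
    finally show ?thesis by (simp add: prod.distrib)
  qed
  also have "[\<dots> \<doteq> fact (2 * n) * 1](3)"
  proof (rule cong_cmult)
    show "pint (fact (2 * n))" using pint_of_nat[of "fact (2 * n)"] by simp
    \<comment> \<open>Modulo p the sum of the corrections becomes -3/4 times the sum of inverse
      squares, which vanishes.\<close>
    have "[sum c {1..n} \<doteq> (\<Sum>j=1..n. - 3/4 * (1 / of_nat j ^ 2))](1)"
    proof (rule cong_sum)
      fix j assume j: "j \<in> {1..n}"
      have "pint (3 * (1/2 * (1/2)))" by (intro pint_mult pint_half) simp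
      hence "[(3/4 * (1 / of_nat j)) * (1 / of_nat (p - j)) \<doteq> (3/4 * (1 / of_nat j)) * - (1 / of_nat j)](1)"
        using j by (intro cong_cmult inverse_reflect pint_mult pint_inverse_small) (auto simp: p_eq)
      thus "[c j \<doteq> - 3/4 * (1 / of_nat j ^ 2)](1)" by (simp add: c_def power2_eq_square mult.assoc)
    qed
    also have "(\<Sum>j=1..n. - 3/4 * (1 / rat_of_nat j ^ 2)) = - 3 * (1/2 * (1/2)) * (\<Sum>j=1..n. 1 / rat_of_nat j ^ 2)"
      by (simp add: sum_distrib_left)
    also have "[\<dots> \<doteq> - 3 * (1/2 * (1/2)) * 0](1)"
      using sum_inverse_squares by (intro cong_cmult pint_mult pint_half pint_minus) simp_all
    finally have "[P ^ 2 * sum c {1..n} \<doteq> P ^ 2 * 0](2 + 1)" by (intro cong_scale) simp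
    hence "[1 + P ^ 2 * sum c {1..n} \<doteq> 1 + 0](3)" by (intro cong_add) simp_all
    thus "[(\<Prod>j=1..n. 1 + P ^ 2 * c j) \<doteq> 1](3)"
      using cong_trans[OF prod_one_plus_cong[of "{1..n}" c]] c by simp
  qed
  finally show ?thesis by simp
qed

section \<open>Binomial coefficients and the Fermat quotient\<close>

lemma of_nat_p_choose_Suc:
  "of_nat (p choose Suc k) = P * (of_nat ((2 * n) choose k) * (1 / of_nat (Suc k)))"
proof -
  have "rat_of_nat (Suc k * (p choose Suc k)) = of_nat (p * ((2 * n) choose k))"
    using Suc_times_binomial[of k "2 * n"] by (simp only: p_eq Suc_eq_plus1)
  thus ?thesis unfolding of_nat_mult by (simp add: field_simps del: of_nat_Suc)
qed

text \<open>By Pascal's rule two neighbouring entries of row \<open>p - 1\<close> add up to an entry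
  of row \<open>p\<close>, which is divisible by p; so the sign alternates.\<close>

lemma binomial_p_minus_1_cong:
  "k \<le> 2 * n \<Longrightarrow> [of_nat ((2 * n) choose k) \<doteq> (- 1) ^ k](1)"
proof (induction k)
  case (Suc k)
  have "[of_nat (p choose Suc k) \<doteq> 0](1)"
    unfolding of_nat_p_choose_Suc
    by (rule congI[where z = "of_nat ((2 * n) choose k) * (1 / of_nat (Suc k))"]) (use Suc.prems in \<open>intro pint_mult pint_inverse_small pint_of_nat, auto simp: p_eq\<close>)
  hence "[of_nat (p choose Suc k) - of_nat ((2 * n) choose k) \<doteq> 0 - (- 1) ^ k](1)"
    using Suc by (intro cong_diff) simp_all
  thus ?case by (simp add: p_eq)
qed simp

text \<open>Expanding \<open>2 ^ p\<close> by binomial coefficients and dividing by p gives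
  \<open>2 * fermat_quotient p 2\<close> as an alternating harmonic sum modulo p; pairing
  \<open>2 * j\<close> with \<open>p - 2 * j\<close> collapses it to
  \<open>- harmonic n\<close>.\<close>

lemma harmonic_half_cong: "[harmonic n \<doteq> - 2 * fermat_quotient p 2](1)"
proof -
  let ?f = "\<lambda>k. rat_of_nat ((2 * n) choose (k - 1)) * (1 / of_nat k)"
  have abs: "of_nat (p choose k) = P * ?f k" if k: "k \<in> {1..2*n}" for k
  proof -
    obtain l where l: "k = Suc l" using k by (cases k) auto
    show ?thesis by (simp only: l of_nat_p_choose_Suc diff_Suc_1)
  qed
  have "(2::rat) ^ p = of_nat (\<Sum>k\<le>p. p choose k)" by (simp only: choose_row_sum) simp
  \<comment> \<open>The indices 0 and p contribute the 2 that is subtracted in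
    \<open>2 ^ p - 2\<close>, which is p times \<open>2 * fermat_quotient p 2\<close>.\<close>
  also have "{..p} = insert 0 (insert p {1..2*n})" by (auto simp: p_eq)
  also have "rat_of_nat (\<Sum>k\<in>\<dots>. p choose k) = 2 + P * (\<Sum>k=1..2*n. ?f k)"
    using abs by (simp add: p_eq sum_distrib_left)
  finally have "2 * fermat_quotient p 2 = (\<Sum>k=1..2*n. ?f k)"
    unfolding fermat_quotient_def by (simp add: p_eq field_simps)
  also have "[\<dots> \<doteq> (\<Sum>k=1..2*n. (- 1) ^ (k - 1) * (1 / of_nat k))](1)"
    by (intro cong_sum cong_mult binomial_p_minus_1_cong cong_refl pint_inverse_small pint_of_nat)
       (auto simp: p_eq)
  also have "(\<Sum>k=1..2*n. (- 1) ^ (k - 1) * (1 / rat_of_nat k)) =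
      (\<Sum>j=1..n. - (1 / of_nat (2 * j)) + 1 / of_nat (p - 2 * j))"
  proof (subst sum_pair_parity, intro sum.cong refl)
    fix j assume "j \<in> {1..n}"
    hence "odd (2 * j - 1)" "even (2 * (n + 1 - j) - 1 - 1)" "2 * (n + 1 - j) - 1 = p - 2 * j"
      by (auto simp: p_eq)
    hence "(- 1) ^ (2 * j - 1) = (- 1 :: rat)" "(- 1) ^ (2 * (n + 1 - j) - 1 - 1) = (1 :: rat)"
      "2 * (n + 1 - j) - 1 = p - 2 * j" by (simp_all only: minus_one_power_iff if_True if_False)
    thus "(- 1) ^ (2 * j - 1) * (1 / rat_of_nat (2 * j)) +
         (- 1) ^ (2 * (n + 1 - j) - 1 - 1) * (1 / rat_of_nat (2 * (n + 1 - j) - 1)) =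
         - (1 / rat_of_nat (2 * j)) + 1 / rat_of_nat (p - 2 * j)"
      by (simp only: mult_minus1 mult_1_left)
  qed
  also have "[\<dots> \<doteq> (\<Sum>j=1..n. - (1 / of_nat (2 * j)) + - (1 / of_nat (2 * j)))](1)"
    by (intro cong_sum cong_add cong_refl inverse_reflect) (auto simp: p_eq)
  also have "\<dots> = - harmonic n"
    by (simp add: harmonic_def sum_negf)
  finally show ?thesis using cong_sym[OF cong_minus] by fastforce
qed

end

section \<open>Euler numbers\<close>

text \<open>In terms of the classical Euler polynomial \<open>E_s\<close> this is
  \<open>2^s * E_s((y + 1) / 2)\<close>. The centred form takes the value
  \<open>euler_number s\<close> at \<open>y = 0\<close>.\<close>

definition euler_poly :: "nat \<Rightarrow> rat \<Rightarrow> rat" where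
  "euler_poly s y = fact s * fps_nth (euler_egf * fps_exp y) s"

text \<open>Adding the two shifts multiplies the generating function by
  \<open>fps_exp 1 + fps_exp (- 1)\<close>, which cancels its denominator.\<close>

lemma euler_poly_shift: "euler_poly s (y + 1) + euler_poly s (y - 1) = 2 * y ^ s"
proof -
  have "euler_egf * fps_exp (y + 1) + euler_egf * fps_exp (y - 1)
      = (euler_egf * (fps_exp 1 + fps_exp (- 1))) * fps_exp y"
    using fps_exp_add_mult[of y 1] fps_exp_add_mult[of y "-1"] by (simp add: algebra_simps)
  also have "\<dots> = 2 * fps_exp y" by (simp add: euler_egf_mult)
  finally have "fps_nth (euler_egf * fps_exp (y + 1)) s + fps_nth (euler_egf * fps_exp (y - 1)) s
      = 2 * (y ^ s / fact s)"
    unfolding fps_add_nth[symmetric] by (simp add: numeral_fps_const)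
  thus ?thesis unfolding euler_poly_def distrib_left[symmetric] by simp
qed

lemma euler_poly_expand:
  "euler_poly s y = (\<Sum>i=0..s. of_nat (s choose i) * euler_number i * y ^ (s - i))"
  unfolding euler_poly_def fps_mult_nth sum_distrib_left
  by (intro sum.cong refl) (simp add: euler_number_def binomial_fact)

text \<open>Taking both signs of the argument makes the value at \<open>m = 0\<close> vanish without knowing that the
  odd Euler numbers are zero.\<close>

lemma euler_poly_alternating_sum:
  assumes "even s" "s > 0"
  shows "(\<Sum>j=1..m. (- 1) ^ j * (4 * (2 * of_nat j) ^ s))
    = (- 1) ^ m * (euler_poly s (2 * of_nat m + 1) + euler_poly s (- (2 * of_nat m + 1)))"
proof (induction m)
  case 0
  show ?case using euler_poly_shift[of s 0] assms by simp
next
  case (Suc m)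
  define y :: rat where "y = 2 * of_nat (Suc m)"
  have y': "2 * of_nat m + 1 = y - 1" "- (2 * of_nat m + 1) = (- y) + 1"
    "- (y + 1) = (- y) - 1"
    by (simp_all add: y_def)
  have "(- y) ^ s = y ^ s" using assms by simp
  hence "euler_poly s (y + 1) + euler_poly s (- (y + 1)) +
      (euler_poly s (2 * of_nat m + 1) + euler_poly s (- (2 * of_nat m + 1))) = 4 * y ^ s"
    unfolding y' using euler_poly_shift[of s y] euler_poly_shift[of s "- y"] by simp
  hence y_pow: "4 * y ^ s = euler_poly s (y + 1) + euler_poly s (- (y + 1)) +
      (euler_poly s (2 * of_nat m + 1) + euler_poly s (- (2 * of_nat m + 1)))" ..
  have "(\<Sum>j=1..Suc m. (- 1) ^ j * (4 * (2 * of_nat j) ^ s)) =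
      (\<Sum>j=1..m. (- 1) ^ j * (4 * (2 * of_nat j) ^ s)) + (- 1) ^ Suc m * (4 * y ^ s)"
    using sum.nat_ivl_Suc'[of 1 m "\<lambda>j. (- 1) ^ j * (4 * (2 * rat_of_nat j) ^ s)"]
    by (simp only: y_def le_add1 Suc_eq_plus1 le_add2 add.commute[of "sum _ _"])
  also have "\<dots> = (- 1) ^ Suc m * (euler_poly s (y + 1) + euler_poly s (- (y + 1)))"
    unfolding Suc.IH y_pow by (simp only: power_Suc algebra_simps)
  finally show ?case unfolding y_def .
qed

text \<open>Euler's criterion gives this modulo p only; equality follows because -1, 0 and 1 are
  distinguished modulo \<open>p > 2\<close>.\<close>

lemma Legendre_minus_1:
  assumes "prime p" "p > 2"
  shows "Legendre (- 1) (int p) = (- 1) ^ ((p - 1) div 2)"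
proof -
  have c: "[Legendre (- 1) (int p) = (- 1) ^ ((p - 1) div 2)] (mod int p)"
    using assms by (intro euler_criterion) auto
  have "\<not> [1 = - 1] (mod int p)" "\<not> [- 1 = 1] (mod int p)"
    "\<not> [0 = 1] (mod int p)" "\<not> [0 = - 1] (mod int p)"
    using assms(2) by (auto simp: cong_iff_dvd_diff dest: zdvd_imp_le)
  thus ?thesis using c by (auto simp: Legendre_def minus_one_power_iff split: if_splits)
qed

context prime_gt_3
begin

text \<open>The shift relation at \<open>y = 0\<close> is a recurrence in which the newest Euler
  number has coefficient 2, so 2 is the only number ever inverted.\<close>

lemma euler_number_pint: "pint (euler_number m)"
proof (induction m rule: less_induct)
  case (less m)
  have "2 * 0 ^ m = euler_poly m 1 + euler_poly m (- 1)"
    using euler_poly_shift[of m 0] by simp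
  also have "\<dots> = (\<Sum>i=0..m. of_nat (m choose i) * euler_number i * (1 + (- 1) ^ (m - i)))"
    by (simp add: euler_poly_expand algebra_simps flip: sum.distrib)
  also have "\<dots> = (\<Sum>i=0..<m. of_nat (m choose i) * euler_number i * (1 + (- 1) ^ (m - i))) + 2 * euler_number m"
    by (simp flip: atLeast0AtMost add: sum.last_plus atLeastLessThanSuc_atLeastAtMost[symmetric])
  finally have e: "euler_number m = 0 ^ m - 1/2 *
      (\<Sum>i=0..<m. of_nat (m choose i) * euler_number i * (1 + (- 1) ^ (m - i)))"
    by simp
  show ?case
    unfolding e by (intro pint_diff pint_power pint_mult pint_half pint_sum pint_add less pint_minus) auto
qed

text \<open>Every term except the constant one contains a positive power of the argument, hence a
  factor p.\<close>

lemma euler_poly_cong: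
  assumes "pint z" shows "[euler_poly s (P * z) \<doteq> euler_number s](1)"
proof (rule congI)
  show "pint (\<Sum>i=0..<s. of_nat (s choose i) * euler_number i * (P ^ (s - i - 1) * z ^ (s - i)))"
    by (intro pint_sum pint_mult pint_power euler_number_pint assms) simp_all
  have "euler_poly s (P * z) = (\<Sum>i=0..<s. of_nat (s choose i) * euler_number i * (P * z) ^ (s - i)) + euler_number s"
    unfolding euler_poly_expand
    by (simp flip: atLeast0AtMost add: sum.last_plus atLeastLessThanSuc_atLeastAtMost[symmetric])
  also have "(\<Sum>i=0..<s. of_nat (s choose i) * euler_number i * (P * z) ^ (s - i)) =
    P * (\<Sum>i=0..<s. of_nat (s choose i) * euler_number i * (P ^ (s - i - 1) * z ^ (s - i)))"
    unfolding sum_distrib_left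
  proof (intro sum.cong refl)
    fix i assume "i \<in> {0..<s}"
    then obtain l where "s - i = Suc l" by (metis Suc_diff_Suc atLeastLessThan_iff)
    thus "of_nat (s choose i) * euler_number i * (P * z) ^ (s - i) =
      P * (of_nat (s choose i) * euler_number i * (P ^ (s - i - 1) * z ^ (s - i)))"
      by (simp add: power_mult_distrib)
  qed
  finally show "euler_poly s (P * z) = euler_number s + P ^ 1 *
      (\<Sum>i=0..<s. of_nat (s choose i) * euler_number i * (P ^ (s - i - 1) * z ^ (s - i)))"
    by simp
qed

lemma fermat_rat:
  assumes "0 < a" "a < p" shows "[of_nat a ^ (p - 1) \<doteq> 1](1)"
proof -
  have "[a ^ (p - 1) = 1] (mod p)"
    using assms prime by (intro fermat_theorem) (auto dest: dvd_imp_le)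
  from cong_of_nat[OF this] show ?thesis by simp
qed

text \<open>By Fermat's theorem \<open>1 / j^2\<close> may be multiplied by
  \<open>(2 * j) ^ (p - 1)\<close>, giving \<open>4 * (2 * j) ^ (p - 3)\<close>. The resulting
  alternating power sum has a closed form in Euler polynomials.\<close>

lemma alternating_sum_inverse_squares:
  "[(\<Sum>j=1..n. (- 1) ^ j / of_nat j ^ 2) \<doteq> (- 1) ^ n * (2 * euler_number (p - 3))](1)"
proof -
  define s where "s = p - 3"
  have s: "even s" "s > 0" "p - 1 = s + 2" using p_gt3 by (auto simp: s_def p_eq)
  have "[(\<Sum>j=1..n. (- 1) ^ j * (1 / of_nat j ^ 2)) \<doteq> (\<Sum>j=1..n. (- 1) ^ j * (4 * (2 * of_nat j) ^ s))](1)"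
  proof (intro cong_sum cong_cmult)
    fix j assume j: "j \<in> {1..n}"
    have "[(1 / of_nat j ^ 2) * of_nat (2 * j) ^ (p - 1) \<doteq> (1 / of_nat j ^ 2) * 1](1)"
      using j by (intro cong_cmult fermat_rat pint_inverse_power pint_inverse_small) (auto simp: p_eq)
    moreover have "(1 / of_nat j ^ 2) * of_nat (2 * j) ^ (p - 1) = 4 * (2 * rat_of_nat j) ^ s"
      using j unfolding s(3) by (simp add: power_add power_mult_distrib power2_eq_square)
    ultimately show "[1 / of_nat j ^ 2 \<doteq> 4 * (2 * of_nat j) ^ s](1)" using cong_sym by simp
  qed simp
  \<comment> \<open>The upper limit \<open>n\<close> puts the arguments of the polynomials at
    \<open>2 * n + 1 = p\<close> and its negative, both divisible by p.\<close>
  also have "(\<Sum>j=1..n. (- 1) ^ j * (4 * (2 * of_nat j) ^ s)) =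
      (- 1) ^ n * (euler_poly s (P * 1) + euler_poly s (P * (- 1)))"
    using euler_poly_alternating_sum[OF s(1,2), of n] by (simp only: P_eq mult_1_right mult_minus1_right)
  also have "[\<dots> \<doteq> (- 1) ^ n * (euler_number s + euler_number s)](1)"
    by (intro cong_cmult cong_add euler_poly_cong pint_power pint_minus) simp_all
  finally show ?thesis by (simp add: s_def)
qed

end

section \<open>Expansion of the WZ terms\<close>

text \<open>By partial fractions the weight is \<open>1/(j-1) - 1/j - 1/(j+1) + 1/(j+2)\<close>,
  whose alternating sum telescopes. The constant 1/3 makes the right side vanish at
  \<open>m = 2\<close>, where the sum is empty.\<close>

lemma alternating_sum_weight:
  assumes "m \<ge> 2"
  shows "(\<Sum>j=2..<m. (- 1) ^ j * ((4 * of_nat j + 2) / (of_nat j * (of_nat j - 1) * ((of_nat j + 1) * (of_nat j + 2)))))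
    = (- 1) ^ m * (2 / of_nat m - 1 / (of_nat m + 1) - 1 / (of_nat m - 1)) + (1/3 :: rat)"
  using assms
proof (induction m rule: dec_induct)
  case (step m)
  define x :: rat where "x = of_nat m"
  have x: "x \<ge> 2" using step by (simp add: x_def)
  have of_nat_m: "of_nat m = x" "of_nat (Suc m) = x + 1" by (simp_all add: x_def)
  define a b c d where "a = 1 / (x - 1)" and "b = 1 / x" and "c = 1 / (x + 1)" and "d = 1 / (x + 2)"
  have v: "(4 * x + 2) / (x * (x - 1) * ((x + 1) * (x + 2))) = a + d - b - c"
    using x by (simp add: a_def b_def c_def d_def divide_simps) (simp add: algebra_simps)
  have frac: "2 / x = 2 * b" "1 / (x + 1) = c" "1 / (x - 1) = a" "2 / (x + 1) = 2 * c"
    "1 / (x + 1 + 1) = d" "1 / (x + 1 - 1) = b"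
    by (simp_all add: a_def b_def c_def d_def)
  show ?case
    unfolding sum.atLeastLessThan_Suc[OF step(1)] step.IH of_nat_m v frac power_Suc
    by (simp add: algebra_simps)
qed simp

text \<open>Summation by parts: relative to \<open>harmonic m\<close> the two harmonic numbers
  differ by a few reciprocals, and their weights 1 and 1/2 give the factor 3/2. Everything
  telescopes except the alternating sum of inverse squares.\<close>

lemma alternating_sum_harmonic_weight:
  assumes "m \<ge> 2"
  shows "(\<Sum>j=2..<m. (- 1) ^ j * (
      (4 * of_nat j + 2) / (of_nat j * (of_nat j - 1) * ((of_nat j + 1) * (of_nat j + 2)))
        * (1 / (of_nat j + 1) + 1 / (of_nat j + 2) + harmonic (j - 2) + harmonic (j + 2) / 2)
      - 1 / (of_nat j * (of_nat j - 1) * ((of_nat j + 1) * (of_nat j + 2)))))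
    = (- 1) ^ m * (3/2 * (2 / of_nat m - 1 / (of_nat m + 1) - 1 / (of_nat m - 1)) * harmonic m
        + 4 / of_nat m - 11/4 / (of_nat m + 1) - 5/4 / (of_nat m - 1)
        - 2 / of_nat m ^ 2 + 1 / (of_nat m - 1) ^ 2 - 3/2 / (of_nat m + 1) ^ 2)
      + 2 * (\<Sum>j=1..m. (- 1) ^ j / of_nat j ^ 2) + 25/12"
  using assms
proof (induction m rule: dec_induct)
  case base
  show ?case by (simp add: numeral_2_eq_2 harmonic_Suc)
next
  case (step m)
  define x :: rat where "x = of_nat m"
  have x: "x \<ge> 2" using step by (simp add: x_def)
  define a b c d where "a = 1 / (x - 1)" and "b = 1 / x" and "c = 1 / (x + 1)" and "d = 1 / (x + 2)"
  \<comment> \<open>Partial fractions make every product of two distinct reciprocals linear, so that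
    \<open>key\<close> becomes a linear comparison.\<close>
  have pf: "1 / y * (1 / z) = (1 / y - 1 / z) / (z - y)" if "y > 0" "z > y" for y z :: rat
    using that by (simp add: field_simps)
  have rel: "a * b = a - b" "b * c = b - c" "c * d = c - d" "a * c = (a - c) / 2"
    "b * d = (b - d) / 2" "a * d = (a - d) / 3"
    unfolding a_def b_def c_def d_def by (subst pf; use x in simp)+
  have v: "(4 * x + 2) / (x * (x - 1) * ((x + 1) * (x + 2))) = a + d - b - c"
    using x by (simp add: a_def b_def c_def d_def divide_simps) (simp add: algebra_simps)
  have w: "1 / (x * (x - 1) * ((x + 1) * (x + 2))) = (a - b) * (c - d)"
    using x by (simp add: a_def b_def c_def d_def divide_simps)
  define h where "h = harmonic m"
  obtain i where i: "m = Suc (Suc i)" using step by (metis add_2_eq_Suc le_Suc_ex)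
  have "harmonic (m - 2) = h - a - b"
    unfolding h_def a_def b_def x_def by (simp add: i harmonic_Suc)
  moreover have H1: "harmonic (Suc m) = h + c"
    by (simp add: harmonic_Suc h_def c_def x_def add.commute)
  moreover have "harmonic (m + 2) = h + c + d"
    using harmonic_Suc[of "Suc m"] H1 by (simp add: d_def x_def add_ac)
  ultimately have H: "harmonic (m - 2) = h - a - b" "harmonic (m + 2) = h + c + d"
    "harmonic (Suc m) = h + c" by simp_all
  \<comment> \<open>This is the induction step without its sign; the leftover
    \<open>- 2 * c ^ 2\<close> is the increment of twice the sum of inverse squares.\<close>
  have key: "(a + d - b - c) * (c + d + (h - a - b) + (h + c + d) / 2) - (a - b) * (c - d)
      + (3/2 * (2 * b - c - a) * h + 4 * b - 11/4 * c - 5/4 * a - 2 * b ^ 2 + a ^ 2 - 3/2 * c ^ 2)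
    = - (3/2 * (2 * c - d - b) * (h + c) + 4 * c - 11/4 * d - 5/4 * b - 2 * c ^ 2 + b ^ 2 - 3/2 * d ^ 2)
      - 2 * c ^ 2"
    using rel
    by (simp add: algebra_simps power2_eq_square add_divide_distrib diff_divide_distrib)
  have of_nat_m: "of_nat m = x" "of_nat (Suc m) = x + 1" by (simp_all add: x_def)
  define S where "S = (\<Sum>j=1..m. (- 1) ^ j / rat_of_nat j ^ 2)"
  have S: "(\<Sum>j=1..Suc m. (- 1) ^ j / rat_of_nat j ^ 2) = S - (- 1) ^ m * c ^ 2"
    by (simp add: S_def c_def x_def power_divide add.commute)
  have frac: "2 / x = 2 * b" "1 / (x + 1) = c" "1 / (x + 2) = d" "1 / (x - 1) = a" "2 / (x + 1) = 2 * c"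
    "1 / (x + 1 + 1) = d" "1 / (x + 1 - 1) = b" "4 / x = 4 * b" "11/4 / (x + 1) = 11/4 * c"
    "5/4 / (x - 1) = 5/4 * a" "2 / x ^ 2 = 2 * b ^ 2" "1 / (x - 1) ^ 2 = a ^ 2"
    "3/2 / (x + 1) ^ 2 = 3/2 * c ^ 2" "4 / (x + 1) = 4 * c" "11/4 / (x + 1 + 1) = 11/4 * d"
    "5/4 / (x + 1 - 1) = 5/4 * b" "2 / (x + 1) ^ 2 = 2 * c ^ 2" "1 / (x + 1 - 1) ^ 2 = b ^ 2"
    "3/2 / (x + 1 + 1) ^ 2 = 3/2 * d ^ 2"
    by (simp_all add: a_def b_def c_def d_def power_divide add_ac)
  define e :: rat where "e = (- 1) ^ m"
  have combine: "e * A + 2 * S + 25/12 + e * T = - 1 * e * B + 2 * (S - e * q) + 25/12"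
    if "T + A = - B - 2 * q" for T A B q :: rat
  proof -
    have T: "T = - B - 2 * q - A" using that by simp
    show ?thesis unfolding T by (simp add: algebra_simps)
  qed
  show ?case
    unfolding sum.atLeastLessThan_Suc[OF step(1)] step.IH of_nat_m v w H frac power_Suc S
      S_def[symmetric] h_def[symmetric] e_def[symmetric]
    by (rule combine[OF key])
qed

context prime_gt_3
begin

text \<open>Together with \<open>pochhammer_symmetric_cong\<close>, this makes the squares of \<open>pochhammer (1/2) k\<close> in the
  WZ terms cancel modulo \<open>p\<^sup>2\<close>.\<close>

lemma fact_n_plus:
  "k \<le> n \<Longrightarrow> fact (n + k) = (- 1) ^ k * fact (n - k) *
     (pochhammer (1/2 + P/2) k * pochhammer (1/2 - P/2) k)"
proof (induction k)
  case (Suc k)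
  then obtain l where l: "n = Suc (k + l)" by (metis Suc_le_lessD less_imp_Suc_add)
  have "(fact (n + Suc k) :: rat) = (of_nat n + of_nat k + 1) * fact (n + k)" by (simp add: algebra_simps)
  also have "fact (n + k) = (- 1) ^ k * fact (n - k) * (pochhammer (1/2 + P/2) k * pochhammer (1/2 - P/2) k)"
    using Suc by simp
  also have "(fact (n - k) :: rat) = (of_nat n - of_nat k) * fact (n - Suc k)"
    by (simp add: l algebra_simps)
  finally have f0: "(fact (n + Suc k) :: rat) = (of_nat n + of_nat k + 1) * ((- 1) ^ k *
      ((of_nat n - of_nat k) * fact (n - Suc k)) *
      (pochhammer (1/2 + P/2) k * pochhammer (1/2 - P/2) k))" .
  have f: "1/2 + P/2 + of_nat k = of_nat n + of_nat k + 1"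
    "1/2 - P/2 + of_nat k = - (of_nat n - of_nat k)" by (simp_all add: P_eq field_simps)
  show ?case unfolding pochhammer_Suc f f0 power_Suc
    by (simp only: mult_minus1 mult_minus_left mult_minus_right minus_minus mult_ac)
qed simp

section \<open>Terms divisible by the square of p\<close>

lemma pint_inverse_linear:
  assumes "coprime c (int p)" shows "pint (1 / (of_int a * P + of_int c))"
proof -
  have "coprime (a * int p + c) (int p)"
    using assms by (simp add: coprime_iff_gcd_eq_1 gcd.commute gcd_add_mult)
  from pint_inverse_int[OF this] show ?thesis by simp
qed

text \<open>The factor of index \<open>n\<close> equals \<open>1/2 + n = P/2\<close>. Splitting
  there isolates an explicit factor p in every WZ term.\<close>

lemma pochhammer_half_split:
  "pochhammer (1/2 :: rat) (n + Suc m) = pochhammer (1/2) n * (P/2) * pochhammer (1 + P/2) m"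
proof -
  have "(1/2 :: rat) + of_nat n = P/2" by (simp add: P_eq)
  thus ?thesis by (simp only: pochhammer_product' pochhammer_rec) (simp add: add.commute)
qed

text \<open>The second source of a factor p. It is available in \<open>wz_F n (n - j)\<close>
  exactly from \<open>j = 2\<close> on, where the factorial in the numerator is that of
  \<open>p + (j - 2)\<close>.\<close>

lemma fact_p_plus: "fact (p + m) = P * fact (2 * n) * (pochhammer (1 + P) m :: rat)"
proof -
  have "fact (p + m) = (pochhammer 1 p * pochhammer (1 + P) m :: rat)"
    by (simp only: pochhammer_fact pochhammer_product')
  thus ?thesis by (simp only: pochhammer_fact[symmetric]) (simp add: p_eq)
qed

lemma pint_inverse_fact: "m < p \<Longrightarrow> pint (1 / fact m)"
proof (induction m)
  case (Suc m)
  have "pint (1 / (of_nat (Suc m) * fact m))"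
    using Suc by (intro pint_inverse_mult pint_inverse_small) auto
  thus ?case by (simp only: fact_Suc)
qed simp

text \<open>One factor p comes from \<open>fact_p_plus\<close>, the other from
  \<open>pochhammer_half_split\<close>. The rest is grouped into four quotients, each congruent to 1
  modulo p, ready for first-order expansion.\<close>

lemma wz_F_eq:
  assumes "2 \<le> j" "j < n"
  shows "wz_F n (n - j) = P ^ 2 * (- 3 * (P - 1) ^ 2 * (- 1) ^ j * (4 * of_nat j + 2 - P)
      / (of_nat j * (of_nat j - 1) * ((P - (of_nat j + 1)) * (P - (of_nat j + 2))))
    * (pochhammer (1/2) n ^ 2 / (pochhammer (1/2 + P/2) n * pochhammer (1/2 - P/2) n)
      * (pochhammer (1/2 + P/2) (n - j) * pochhammer (1/2 - P/2) (n - j) / pochhammer (1/2) (n - j) ^ 2)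
      * (pochhammer (1 + P) (j - 2) / fact (j - 2))
      * (pochhammer (1 + P/2) (2 * n - (j + 2)) / fact (2 * n - (j + 2)))))"
proof -
  define k m where "k = n - j" and "m = 2 * n - (j + 2)"
  define x where "x = rat_of_nat j"
  have x: "x \<ge> 2" "P - (x + 1) > 0" "P - (x + 2) > 0" "P - 1 > 0"
    using assms n_ge by (simp_all add: x_def P_eq)
  define A B C D where "A = pochhammer (1 + P) (j - 2)" and "B = pochhammer (1/2 :: rat) n"
    and "C = pochhammer (1 + P/2) m" and "D = pochhammer (1/2 :: rat) k"
  define Yn Yk where "Yn = pochhammer (1/2 + P/2) n * pochhammer (1/2 - P/2) n"
    and "Yk = pochhammer (1/2 + P/2) k * pochhammer (1/2 - P/2) k"
  define F J M :: rat where "F = fact (2 * n - 1)" and "J = fact (j - 2)" and "M = fact m"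
  have ix: "3 * n - k - 1 = p + (j - 2)" "2 * n + k - 1 = n + Suc m" "n - k = j" "2 * n = Suc (2 * n - 1)"
    "j = Suc (Suc (j - 2))" "n + k = Suc (Suc m)"
    using assms n_ge by (auto simp: k_def m_def p_eq)
  have of_nat_k: "2 * of_nat n + 1 - 4 * rat_of_nat k = 4 * x + 2 - P"
    using assms by (simp add: k_def x_def P_eq of_nat_diff)
  have fact_2n: "fact (2 * n) = (P - 1) * F"
    using fact_reduce[of "2 * n", where 'a=rat] n_ge by (simp add: F_def P_eq)
  have fact_j: "fact j = x * (x - 1) * J"
    unfolding J_def x_def by (subst (1 2 3) ix(5)) (simp add: algebra_simps)
  have fact_nk: "fact (n + k) = (P - (x + 1)) * (P - (x + 2)) * M"
  proof -
    have "P - (x + 1) = of_nat m + 2" "P - (x + 2) = of_nat m + 1"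
      using assms by (simp_all add: m_def x_def P_eq of_nat_diff)
    thus ?thesis unfolding ix(6) M_def by (simp add: algebra_simps)
  qed
  \<comment> \<open>These two relations trade \<open>F\<close> and \<open>M\<close> for
    \<open>Yn\<close> and \<open>Yk\<close>, so that the squares of \<open>B\<close> and
    \<open>D\<close> appear in quotients with \<open>Yn\<close> and \<open>Yk\<close>.\<close>
  have Yn: "(P - 1) * F = (- 1) ^ n * Yn"
    using fact_n_plus[of n] fact_2n by (simp add: Yn_def mult_2)
  have Yk: "(P - (x + 1)) * (P - (x + 2)) * M = (- 1) ^ k * (x * (x - 1) * J) * Yk"
    using fact_n_plus[of k] unfolding fact_nk ix(3) fact_j by (simp add: Yk_def k_def)
  have pos: "F > 0" "J > 0" "M > 0" "B > 0" "D > 0"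
    by (simp_all add: F_def J_def M_def B_def D_def pochhammer_pos)
  have "Yn \<noteq> 0" "Yk \<noteq> 0" using Yn Yk pos x by auto
  have sgn: "(- 1) ^ j = (- 1 :: rat) ^ n * (- 1) ^ k"
    using assms by (simp add: k_def minus_one_power_iff)
  have "wz_F n k = - 6 * (4 * x + 2 - P) * (P * ((P - 1) * F) * A) * (B * (P/2) * C) * B
      / ((x * (x - 1) * J) ^ 2 * D ^ 2 * F ^ 2)"
    unfolding wz_F_def ix(1-3) of_nat_k fact_p_plus fact_2n pochhammer_half_split fact_j
    by (simp add: A_def B_def C_def D_def F_def)
  also have "\<dots> = P ^ 2 * (- 3 * (P - 1) ^ 2 * (- 1) ^ j * (4 * x + 2 - P)
      / (x * (x - 1) * ((P - (x + 1)) * (P - (x + 2))))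
    * (B ^ 2 / Yn * (Yk / D ^ 2) * (A / J) * (C / M)))"
  proof -
    define r s :: rat where "r = (- 1) ^ n" and "s = (- 1) ^ k"
    have rs: "r * r = 1" "s * s = 1" by (simp_all add: r_def s_def flip: power_add)
    define u t where "u = x * (x - 1)" and "t = (P - (x + 1)) * (P - (x + 2))"
    have nz: "u \<noteq> 0" "t \<noteq> 0" "F \<noteq> 0" "J \<noteq> 0" "M \<noteq> 0" "D \<noteq> 0" "P - 1 \<noteq> 0" using x pos by (auto simp: u_def t_def)
    have M: "M = s * u * J * Yk / t"
      using Yk nz by (simp add: u_def t_def s_def field_simps)
    have F: "F = r * Yn / (P - 1)" using Yn nz by (simp add: r_def field_simps)
    have nz': "r \<noteq> 0" "s \<noteq> 0" using rs by auto
    have "- 6 * (4 * x + 2 - P) * (P * ((P - 1) * F) * A) * (B * (P/2) * C) * B / ((u * J) ^ 2 * D ^ 2 * F ^ 2)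
      = - 3 * P ^ 2 * (4 * x + 2 - P) * (P - 1) * A * B ^ 2 * C / (u ^ 2 * J ^ 2 * D ^ 2) * (1 / F)"
      using nz by (simp add: field_simps power2_eq_square)
    also have "1 / F = (P - 1) * r / Yn"
      using \<open>Yn \<noteq> 0\<close> nz nz' rs by (simp add: F field_simps)
    also have "- 3 * P ^ 2 * (4 * x + 2 - P) * (P - 1) * A * B ^ 2 * C / (u ^ 2 * J ^ 2 * D ^ 2) * ((P - 1) * r / Yn)
      = P ^ 2 * (- 3 * (P - 1) ^ 2 * (r * s) * (4 * x + 2 - P) / (u * t)
        * (B ^ 2 / Yn * (Yk / D ^ 2) * (A / J) * (C / M)))"
      using \<open>Yn \<noteq> 0\<close> \<open>Yk \<noteq> 0\<close> nz nz' rs by (simp add: M field_simps power2_eq_square)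
    finally show ?thesis unfolding sgn r_def s_def u_def t_def .
  qed
  finally show ?thesis
    by (simp only: A_def B_def C_def D_def Yn_def Yk_def J_def M_def k_def m_def x_def)
qed

text \<open>First-order Taylor expansion in p of a rational function with unit denominators.\<close>

lemma reciprocal_expansion:
  assumes "a \<noteq> 0" "b \<noteq> 0" "P - a \<noteq> 0" "P - b \<noteq> 0"
    and "pint c" "pint a" "pint b" "pint (1 / a)" "pint (1 / b)" "pint (1 / (P - a))" "pint (1 / (P - b))"
  shows "[(c - P) / ((P - a) * (P - b)) \<doteq> c / (a * b) + P * (c / (a * b) * (1 / a + 1 / b) - 1 / (a * b))](2)"
proof (rule congI)
  \<comment> \<open>\<open>z\<close> is the value at \<open>P = 0\<close> and \<open>y\<close> the
    coefficient of \<open>P\<close>; the remainder is read off after multiplying by the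
    denominator.\<close>
  define z y where "z = c / (a * b)" and "y = z * (1 / a + 1 / b) - 1 / (a * b)"
  have "z = c * (1 / a) * (1 / b)" "y = c * (1 / a) * (1 / b) * (1 / a + 1 / b) - 1 / a * (1 / b)"
    by (simp_all add: z_def y_def)
  hence "pint z" "pint y" by (simp_all only:) (intro pint_mult pint_add pint_diff assms)+
  thus "pint (- ((z - (a + b) * y + P * y) * (1 / (P - a) * (1 / (P - b)))))"
    by (intro pint_minus pint_mult pint_add pint_diff assms) simp_all
  have eq: "z * (a * b) = c" "y * (a * b) = (a + b) * z - 1"
    using assms by (simp_all add: z_def y_def field_simps)
  define w where "w = (P - a) * (P - b)"
  have w: "w \<noteq> 0" using assms by (simp add: w_def)
  have "(z + P * y) * w = z * (a * b) + P * (y * (a * b) - (a + b) * z)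
      + P ^ 2 * (z - (a + b) * y + P * y)"
    by (simp add: w_def algebra_simps power2_eq_square)
  hence "c - P = (z + P * y) * w - P ^ 2 * (z - (a + b) * y + P * y)"
    unfolding eq by simp
  hence "(c - P) / w = z + P * y + P ^ 2 * - ((z - (a + b) * y + P * y) * (1 / w))"
    using w by (simp add: field_simps)
  thus "(c - P) / ((P - a) * (P - b)) = c / (a * b) + P * (c / (a * b) * (1 / a + 1 / b) - 1 / (a * b))
      + P ^ 2 * - ((z - (a + b) * y + P * y) * (1 / (P - a) * (1 / (P - b))))"
    unfolding z_def[symmetric] y_def[symmetric] by (simp add: w_def)
qed

lemma pochhammer_quotient_cong:
  assumes "pint c" "m < p"
  shows "[pochhammer (1 + P * c) m / fact m \<doteq> 1 + P * (c * harmonic m)](2)"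
  using cong_divide[OF pint_inverse_fact[OF assms(2)] pochhammer_cong[OF assms]]
  by (simp add: mult.assoc)

text \<open>Modulo p^2 the two quotients with symmetric shifts equal 1, the other two contribute
  harmonic corrections, and the rational factor is expanded by \<open>reciprocal_expansion\<close>.
  The factor \<open>(P - 1) ^ 2\<close> does not depend on \<open>j\<close> and stays
  unexpanded.\<close>

lemma wz_F_cong:
  assumes j: "2 \<le> j" "j < n"
  shows "[wz_F n (n - j) \<doteq> P ^ 2 * (- 3 * (P - 1) ^ 2 * ((- 1) ^ j *
      ((4 * of_nat j + 2) / (of_nat j * (of_nat j - 1) * ((of_nat j + 1) * (of_nat j + 2))))
     + P * ((- 1) ^ j * (
      (4 * of_nat j + 2) / (of_nat j * (of_nat j - 1) * ((of_nat j + 1) * (of_nat j + 2)))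
        * (1 / (of_nat j + 1) + 1 / (of_nat j + 2) + harmonic (j - 2) + harmonic (j + 2) / 2)
      - 1 / (of_nat j * (of_nat j - 1) * ((of_nat j + 1) * (of_nat j + 2)))))))](4)"
proof -
  define k m where "k = n - j" and "m = 2 * n - (j + 2)"
  define x where "x = rat_of_nat j"
  define h where "h = harmonic (j - 2) + harmonic (j + 2) / 2"
  have lt: "m < p" "j - 2 < p" "j + 2 < p" "j + 1 < p" "j - 1 < p" "j < p" "k \<le> n"
    using j n_ge by (auto simp: m_def p_eq k_def)
  define U1 U2 U3 U4 where
    "U1 = pochhammer (1/2) n ^ 2 / (pochhammer (1/2 + P/2) n * pochhammer (1/2 - P/2) n)"
    and "U2 = pochhammer (1/2 + P/2) k * pochhammer (1/2 - P/2) k / pochhammer (1/2) k ^ 2"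
    and "U3 = pochhammer (1 + P) (j - 2) / fact (j - 2)"
    and "U4 = pochhammer (1 + P/2) m / fact m"
  define Y where "Y = pochhammer (1/2 + P/2) n * pochhammer (1/2 - P/2) n"
  have Y: "fact (2 * n) = (- 1) ^ n * Y" using fact_n_plus[of n] by (simp add: Y_def mult_2)
  have "Y \<noteq> 0"
  proof
    assume "Y = 0" thus False using Y by simp
  qed
  \<comment> \<open>Up to sign \<open>Y\<close> is \<open>fact (2 * n)\<close>, the factorial of
    \<open>p - 1\<close>, and therefore a unit modulo p.\<close>
  have "1 / Y = (- 1) ^ n * (1 / fact (2 * n))"
    unfolding Y using \<open>Y \<noteq> 0\<close> by (simp add: divide_simps)
  hence "pint (1 / Y)"
    by (simp only:) (intro pint_mult pint_inverse_fact pint_minus_one_power, simp add: p_eq)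
  have "[pochhammer (1/2) n ^ 2 / Y \<doteq> Y / Y](2)"
    unfolding Y_def
    by (intro cong_divide cong_sym[OF pochhammer_symmetric_cong] \<open>pint (1 / Y)\<close>[unfolded Y_def])
  hence U1: "[U1 \<doteq> 1](2)" using \<open>Y \<noteq> 0\<close> by (simp add: U1_def Y_def)
  have "pochhammer (1/2 :: rat) k \<noteq> 0" by (rule less_imp_neq[THEN not_sym]) (simp add: pochhammer_pos)
  hence U2: "[U2 \<doteq> 1](2)"
    using cong_divide[OF pint_inverse_power[OF pint_inverse_pochhammer_half[OF lt(7)], of 2]
        pochhammer_symmetric_cong[of k]]
    by (simp add: U2_def)
  have U3: "[U3 \<doteq> 1 + P * harmonic (j - 2)](2)"
    using pochhammer_quotient_cong[of 1 "j - 2"] lt by (simp add: U3_def)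
  \<comment> \<open>Reflection holds only modulo p, which suffices because this harmonic number
    enters with a factor p.\<close>
  have "[1/2 * harmonic m \<doteq> 1/2 * harmonic (j + 2)](1)"
    unfolding m_def using j by (intro cong_cmult pint_half harmonic_reflect) auto
  hence "[1 + P ^ 1 * (1/2 * harmonic m) \<doteq> 1 + P ^ 1 * (1/2 * harmonic (j + 2))](1 + 1)"
    by (intro cong_add cong_refl cong_scale)
  hence "[1 + P * (1/2 * harmonic m) \<doteq> 1 + P * (1/2 * harmonic (j + 2))](2)"
    by (simp only: power_one_right one_add_one)
  hence U4: "[U4 \<doteq> 1 + P * (1/2 * harmonic (j + 2))](2)"
    using cong_trans[OF pochhammer_quotient_cong[OF pint_half lt(1)]] by (simp add: U4_def)
  have ph: "pint (harmonic (j - 2))" "pint (harmonic (j + 2))" using lt by (simp_all add: pint_harmonic)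
  have pints: "pint (1 + P * harmonic (j - 2))" "pint (1 + P * (1/2 * harmonic (j + 2)))"
    by (intro pint_add pint_mult pint_half ph pint_1 pint_of_nat)+
  have "[U1 * U2 * U3 * U4 \<doteq> 1 * 1 * (1 + P * harmonic (j - 2)) * (1 + P * (1/2 * harmonic (j + 2)))](2)"
    using cong_pint[OF U1] cong_pint[OF U2] cong_pint[OF U3] pints
    by (intro cong_mult U1 U2 U3 U4 pint_mult) simp_all
  also have "[1 * 1 * (1 + P * harmonic (j - 2)) * (1 + P * (1/2 * harmonic (j + 2))) \<doteq> 1 + P * h](2)"
  proof (rule congI)
    show "pint (harmonic (j - 2) * (1/2 * harmonic (j + 2)))"
      by (intro pint_mult ph pint_half)
  qed (simp add: h_def algebra_simps power2_eq_square)
  finally have U: "[U1 * U2 * U3 * U4 \<doteq> 1 + P * h](2)" .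
  have p1: "pint (1 / (x + 1))" "pint (1 / (x + 2))" "pint (1 / x)" "pint (1 / (x - 1))"
    using pint_inverse_small[of "j + 1"] pint_inverse_small[of "j + 2"] pint_inverse_small[of j]
      pint_inverse_small[of "j - 1"] lt j
    by (simp_all add: x_def of_nat_diff add_ac)
  have Px: "P - (x + 1) = of_nat (2 * n - j)" "P - (x + 2) = of_nat (2 * n - j - 1)"
    using j by (simp_all add: x_def P_eq of_nat_diff)
  have p2: "pint (1 / (P - (x + 1)))" "pint (1 / (P - (x + 2)))"
    unfolding Px using j by (intro pint_inverse_small; simp add: p_eq)+
  have x2: "x \<ge> 2" using j by (simp add: x_def)
  have nz: "x + 1 \<noteq> 0" "x + 2 \<noteq> 0" "P - (x + 1) \<noteq> 0" "P - (x + 2) \<noteq> 0"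
    using x2 Px j by auto
  define t where "t = (x + 1) * (x + 2)"
  define Z where "Z = (4 * x + 2) / t + P * ((4 * x + 2) / t * (1 / (x + 1) + 1 / (x + 2)) - 1 / t)"
  have px: "pint x" "pint (4 * x + 2)" "pint (x + 1)" "pint (x + 2)"
    by (auto simp: x_def intro!: pint_add pint_mult)
  have X: "[(4 * x + 2 - P) / ((P - (x + 1)) * (P - (x + 2))) \<doteq> Z](2)"
    unfolding Z_def t_def by (rule reciprocal_expansion) (fact nz px p1 p2)+
  have pt: "pint (1 / t)" unfolding t_def by (intro pint_inverse_mult p1)
  have pct: "pint ((4 * x + 2) / t)" by (rule pint_divide[OF px(2) pt])
  have pcq: "pint ((4 * x + 2) / t * (1 / (x + 1) + 1 / (x + 2)) - 1 / t)"
    by (intro pint_diff pint_mult pint_add pt p1 pct)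
  have pZ: "pint Z" unfolding Z_def by (intro pint_add pint_mult pcq pct pint_of_nat)
  have ph': "pint h" unfolding h_def using pint_mult[OF ph(2) pint_half] by (intro pint_add ph) simp
  have X_U: "[(4 * x + 2 - P) / ((P - (x + 1)) * (P - (x + 2))) * (U1 * U2 * U3 * U4) \<doteq> Z * (1 + P * h)](2)"
    by (intro cong_mult X U cong_pint[OF X pZ] pint_add pint_mult pint_of_nat ph' pint_1)
  have expand: "(z + q * (z * s - r)) * (1 + q * h) = z + q * (z * (s + h) - r) + q ^ 2 * ((z * s - r) * h)"
    for z q s r h :: rat by (simp add: algebra_simps power2_eq_square)
  note X_U
  also have "[Z * (1 + P * h) \<doteq> (4 * x + 2) / t + P * ((4 * x + 2) / t * (1 / (x + 1) + 1 / (x + 2) + h) - 1 / t)](2)"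
  proof (rule congI)
    show "pint (((4 * x + 2) / t * (1 / (x + 1) + 1 / (x + 2)) - 1 / t) * h)"
      by (intro pint_mult pcq ph')
    show "Z * (1 + P * h) = (4 * x + 2) / t + P * ((4 * x + 2) / t * (1 / (x + 1) + 1 / (x + 2) + h) - 1 / t)
       + P ^ 2 * (((4 * x + 2) / t * (1 / (x + 1) + 1 / (x + 2)) - 1 / t) * h)"
      unfolding Z_def by (rule expand)
  qed
  finally have main: "[(4 * x + 2 - P) / ((P - (x + 1)) * (P - (x + 2))) * (U1 * U2 * U3 * U4) \<doteq>
      (4 * x + 2) / t + P * ((4 * x + 2) / t * (1 / (x + 1) + 1 / (x + 2) + h) - 1 / t)](2)" .
  have pR: "pint (- 3 * (P - 1) ^ 2 * (- 1) ^ j * (1 / (x * (x - 1))))"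
    by (intro pint_mult pint_inverse_mult p1 pint_power pint_diff pint_minus_one_power pint_minus) simp_all
  have "wz_F n (n - j) = P ^ 2 * (- 3 * (P - 1) ^ 2 * (- 1) ^ j * (1 / (x * (x - 1))) *
     ((4 * x + 2 - P) / ((P - (x + 1)) * (P - (x + 2))) * (U1 * U2 * U3 * U4)))"
    unfolding wz_F_eq[OF j] U1_def U2_def U3_def U4_def k_def m_def x_def by (simp add: mult.assoc)
  also have "[\<dots> \<doteq> P ^ 2 * (- 3 * (P - 1) ^ 2 * (- 1) ^ j * (1 / (x * (x - 1))) *
      ((4 * x + 2) / t + P * ((4 * x + 2) / t * (1 / (x + 1) + 1 / (x + 2) + h) - 1 / t)))](4)"
    using cong_scale[OF cong_cmult[OF pR main], of 2] by (simp only: numeral_plus_numeral arith_simps)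
  also have "- 3 * (P - 1) ^ 2 * (- 1) ^ j * (1 / (x * (x - 1))) *
      ((4 * x + 2) / t + P * ((4 * x + 2) / t * (1 / (x + 1) + 1 / (x + 2) + h) - 1 / t))
    = - 3 * (P - 1) ^ 2 * ((- 1) ^ j * ((4 * x + 2) / (x * (x - 1) * t))
      + P * ((- 1) ^ j * ((4 * x + 2) / (x * (x - 1) * t) * (1 / (x + 1) + 1 / (x + 2) + h) - 1 / (x * (x - 1) * t))))"
  proof -
    define u v e f where "u = 1 / (x * (x - 1))" and "v = 1 / t" and "e = 1 / (x + 1) + 1 / (x + 2) + h"
      and "f = (- 1 :: rat) ^ j"
    define r where "r = 4 * x + 2"
    have eqs: "r / t = r * v" "r / (x * (x - 1) * t) = r * u * v"
      "1 / (x * (x - 1) * t) = u * v" "1 / t = v"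
      by (simp_all add: u_def v_def)
    show ?thesis
      unfolding r_def[symmetric] unfolding eqs u_def[symmetric] e_def[symmetric] f_def[symmetric]
      by (simp add: algebra_simps)
  qed
  finally show ?thesis
    unfolding h_def t_def x_def by (simp only: add.assoc)
qed

section \<open>The two terms divisible only by p\<close>

lemma coprime_small_int: "0 < k \<Longrightarrow> k < int p \<Longrightarrow> coprime k (int p)"
  using coprime_small[of "nat k"] by (simp flip: coprime_int_iff)

lemma coprime_2: "coprime 2 (int p)" and coprime_3: "coprime 3 (int p)" and coprime_4: "coprime 4 (int p)"
  using p_gt3 coprime_small_int[of 2] coprime_small_int[of 3] coprime_mult_left_iff[of 2 2 "int p"] by simp_all

lemma pint_inverse_quadratic: "pint (1 / ((3 * P - 4) * (3 * P - 2)))"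
  using pint_inverse_linear[of "-4" 3] pint_inverse_linear[of "-2" 3] coprime_2 coprime_4
  by (intro pint_inverse_mult) simp_all

text \<open>With only one factor p available, the rest is needed modulo p^3. Both terms are
  multiples of \<open>R\<close>, and \<open>R\<close> differs from \<open>W\<close> by three linear
  factors in p; as \<open>W / fact (2 * n)\<close> is 1 modulo p^3, a rational function of p
  remains.\<close>

lemma last_terms_cong:
  "[wz_F n (n - 1) + wz_F n n \<doteq> 6 * P + P ^ 2 + 17/4 * P ^ 3](4)"
proof -
  obtain i where i: "n = Suc (Suc i)" using n_ge by (metis add_2_eq_Suc le_Suc_ex)
  define R where "R = pochhammer (1 + P/2) (2 * n - 3)"
  define W where "W = pochhammer (1 + P/2) (2 * n)"
  define B B' where "B = pochhammer (1/2 :: rat) n" and "B' = pochhammer (1/2 :: rat) (n - 1)"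
  define F :: rat where "F = fact (2 * n - 1)"
  define q where "q = (3 * P - 4) * (3 * P - 2)"
  have P5: "P \<ge> 5" using n_ge by (simp add: P_eq)
  have pos: "B' > 0" "F > 0" "P > 0" "P - 1 > 0" "P - 2 > 0" "3 * P - 4 > 0" "3 * P - 2 > 0"
    using P5 by (auto simp: B'_def F_def pochhammer_pos)
  have B: "B = B' * ((P - 2) / 2)"
    using pochhammer_Suc[of "1/2 :: rat" "n - 1"] by (simp add: B_def B'_def i P_eq field_simps)
  have "B > 0" by (simp add: B_def pochhammer_pos)
  have fact_2n: "fact (2 * n) = (P - 1) * F"
    using fact_reduce[of "2 * n", where 'a=rat] n_ge by (simp add: F_def P_eq)
  have idx: "Suc (2 * n - 3) = 2 * n - 2" "Suc (2 * n - 2) = 2 * n - 1" "Suc (2 * n - 1) = 2 * n"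
    using n_ge by auto
  have shift: "1 + P/2 + of_nat (2 * n - 3) = (3 * P - 6) / 2" "1 + P/2 + of_nat (2 * n - 2) = (3 * P - 4) / 2"
    "1 + P/2 + of_nat (2 * n - 1) = (3 * P - 2) / 2"
    using n_ge by (simp_all add: P_eq of_nat_diff field_simps)
  have R2: "pochhammer (1 + P/2) (2 * n - 2) = R * ((3 * P - 6) / 2)"
    using pochhammer_Suc[of "1 + P/2" "2 * n - 3"] unfolding idx shift R_def .
  have R1: "pochhammer (1 + P/2) (2 * n - 1) = R * ((3 * P - 6) / 2) * ((3 * P - 4) / 2)"
    using pochhammer_Suc[of "1 + P/2" "2 * n - 2"] unfolding idx shift R2 .
  have W: "W = R * ((3 * P - 6) / 2) * ((3 * P - 4) / 2) * ((3 * P - 2) / 2)"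
    using pochhammer_Suc[of "1 + P/2" "2 * n - 1"] unfolding idx shift R1 W_def .
  have ix: "3 * n - n - 1 = 2 * n - 1" "2 * n + n - 1 = n + Suc (2 * n - 2)" "3 * n - (n - 1) - 1 = 2 * n"
     "2 * n + (n - 1) - 1 = n + Suc (2 * n - 3)" "n - n = 0" "n - (n - 1) = 1"
    using n_ge by auto
  have coef: "2 * rat_of_nat n + 1 - 4 * rat_of_nat n = 2 - P" by (simp add: P_eq)
  have "wz_F n n = - 6 * (2 - P) * F * (B * (P/2) * (R * ((3 * P - 6) / 2))) * B / (B ^ 2 * F ^ 2)"
    unfolding wz_F_def ix pochhammer_half_split R2 coef by (simp add: F_def B_def)
  also have "\<dots> = 3/2 * P * (P - 2) * (3 * P - 6) * R / F"
  proof -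
    have "- 6 * (- u) * F * (B * (P/2) * (R * (w/2))) * B / (B ^ 2 * F ^ 2) = 3/2 * P * u * w * R / F" for u w
      using pos \<open>B > 0\<close> by (simp add: power2_eq_square)
    from this[of "P - 2" "3 * P - 6"] show ?thesis by simp
  qed
  finally have F1: "wz_F n n = 3/2 * P * (P - 2) * (3 * P - 6) * R / F" .
  have coef': "2 * rat_of_nat n + 1 - 4 * rat_of_nat (n - 1) = 6 - P" by (simp add: i P_eq)
  have "wz_F n (n - 1) = - 6 * (6 - P) * ((P - 1) * F) * (B * (P/2) * R) * B / (B' ^ 2 * F ^ 2)"
    unfolding wz_F_def ix pochhammer_half_split fact_2n coef' by (simp add: F_def B_def B'_def R_def)
  also have "\<dots> = 3/4 * P * (P - 6) * (P - 1) * (P - 2) ^ 2 * R / F"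
  proof -
    have "- 6 * (- v) * (s * F) * (B' * (u/2) * (P/2) * R) * (B' * (u/2)) / (B' ^ 2 * F ^ 2)
        = 3/4 * P * v * s * u ^ 2 * R / F" for u v s
      using pos by (simp add: power2_eq_square)
    from this[of "P - 6" "P - 1" "P - 2"] show ?thesis unfolding B by simp
  qed
  finally have F2: "wz_F n (n - 1) = 3/4 * P * (P - 6) * (P - 1) * (P - 2) ^ 2 * R / F" .
  have cancel: "y = 8 * w / v" if "w = y * v / 8" "v \<noteq> 0" for y w v :: rat
    using that by (simp add: field_simps)
  have "W = R * (3 * (P - 2) * q) / 8"
  proof -
    have "3 * P - 6 = 3 * (P - 2)" by simp
    thus ?thesis unfolding W q_def by simp
  qed
  moreover have "3 * (P - 2) * q \<noteq> 0" using pos by (simp add: q_def)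
  \<comment> \<open>The factor \<open>P - 2\<close> in this denominator cancels against the common
    factor of the two terms, leaving only \<open>q\<close>, whose constant term is 8.\<close>
  ultimately have R: "R = 8 * W / (3 * (P - 2) * q)"
    by (rule cancel)
  have "wz_F n (n - 1) + wz_F n n = 3/4 * P * (P - 2) * ((P - 6) * (P - 1) * (P - 2) + 6 * (P - 2)) * R / F"
    unfolding F1 F2 using pos by (simp add: field_simps power2_eq_square)
  also have "\<dots> = P * (2 * (P - 1) * (P - 2) * ((P - 6) * (P - 1) + 6)) * (1 / q) * (W / fact (2 * n))"
  proof -
    define r where "r = (P - 6) * (P - 1) + 6"
    define t where "t = P - 2"
    define s where "s = P - 1"
    have nz: "q \<noteq> 0" "F \<noteq> 0" "s \<noteq> 0" "t \<noteq> 0" using pos by (auto simp: q_def s_def t_def)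
    have rt: "(P - 6) * (P - 1) * (P - 2) + 6 * (P - 2) = r * t" by (simp add: r_def t_def algebra_simps)
    show ?thesis
      unfolding rt R fact_2n unfolding r_def[symmetric] unfolding s_def[symmetric] t_def[symmetric]
      using nz by (simp add: field_simps)
  qed
  finally have eq: "wz_F n (n - 1) + wz_F n n =
    P ^ 1 * ((2 * (P - 1) * (P - 2) * ((P - 6) * (P - 1) + 6)) * (1 / q) * (W / fact (2 * n)))" by simp
  have pq: "pint (1 / q)" unfolding q_def by (rule pint_inverse_quadratic)
  have "[W / fact (2 * n) \<doteq> fact (2 * n) / fact (2 * n)](3)"
    unfolding W_def by (intro cong_divide pochhammer_half_shift_cong pint_inverse_fact) (simp add: p_eq)
  hence "[wz_F n (n - 1) + wz_F n n \<doteq>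
      P ^ 1 * ((2 * (P - 1) * (P - 2) * ((P - 6) * (P - 1) + 6)) * (1 / q) * 1)](1 + 3)"
    unfolding eq by (intro cong_scale cong_cmult pint_mult pq pint_add pint_diff) simp_all
  also have "[P ^ 1 * ((2 * (P - 1) * (P - 2) * ((P - 6) * (P - 1) + 6)) * (1 / q) * 1) \<doteq>
      6 * P + P ^ 2 + 17/4 * P ^ 3](1 + 3)"
  proof (rule congI)
    \<comment> \<open>The witness is the remainder of the numerator after subtracting the cubic
      times \<open>q\<close>, divided by p^4. Quarters are written as products of 1/2 so that
      \<open>pint_half\<close> applies.\<close>
    show "pint ((95 * (1/2) - 145 * (1/2 * (1/2)) * P) * (1 / q))"
      by (intro pint_mult pint_diff pint_half pq) simp_all
    have q: "q \<noteq> 0" using pos by (simp add: q_def)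
    have "P * (2 * (P - 1) * (P - 2) * ((P - 6) * (P - 1) + 6)) =
      (6 * P + P ^ 2 + 17/4 * P ^ 3) * q + P ^ (1 + 3) * (95 * (1/2) - 145 * (1/2 * (1/2)) * P)"
      by (simp add: q_def algebra_simps power2_eq_square power3_eq_cube power4_eq_xxxx)
    moreover have "a ^ 1 * (b * (1 / q) * 1) = c + d * (z * (1 / q))" if "a * b = c * q + d * z"
      for a b c d z
      using q that by (simp add: field_simps)
    ultimately show "P ^ 1 * ((2 * (P - 1) * (P - 2) * ((P - 6) * (P - 1) + 6)) * (1 / q) * 1) =
      6 * P + P ^ 2 + 17/4 * P ^ 3 + P ^ (1 + 3) * ((95 * (1/2) - 145 * (1/2 * (1/2)) * P) * (1 / q))"
      by blast
  qed
  finally show ?thesis by simp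
qed

section \<open>Assembling the sum modulo the fourth power of p\<close>

lemma pint_inverse_P_minus:
  "pint (1 / (P - 1))" "pint (1 / (P + 1))" "pint (1 / (P - 3))"
  using pint_inverse_linear[of "-1" 1] pint_inverse_linear[of 1 1] pint_inverse_linear[of "-3" 1] coprime_3
  by simp_all

lemma pint_third: "pint (1/3)"
  using pint_inverse_small[of 3] p_gt3 by simp

text \<open>Geometric series to first order. They enter because \<open>1/n\<close>,
  \<open>1/(n+1)\<close> and \<open>1/(n-1)\<close> are twice these reciprocals.\<close>

lemma inverse_P_minus_cong:
  "[1 / (P - 1) \<doteq> - 1 - P](2)" "[1 / (P + 1) \<doteq> 1 - P](2)" "[1 / (P - 3) \<doteq> - 1/3 - 1/9 * P](2)"
proof -
  have P5: "P \<ge> 5" using n_ge by (simp add: P_eq)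
  show "[1 / (P - 1) \<doteq> - 1 - P](2)"
    by (rule congI[OF pint_inverse_P_minus(1)]) (use P5 in \<open>simp add: field_simps power2_eq_square\<close>)
  show "[1 / (P + 1) \<doteq> 1 - P](2)"
    by (rule congI[OF pint_inverse_P_minus(2)]) (use P5 in \<open>simp add: field_simps power2_eq_square\<close>)
  have "pint (1/3 * (1/3) * (1 / (P - 3)))" by (intro pint_mult pint_third pint_inverse_P_minus)
  thus "[1 / (P - 3) \<doteq> - 1/3 - 1/9 * P](2)"
    by (rule congI) (use P5 in \<open>simp add: field_simps power2_eq_square\<close>)
qed

text \<open>Behind the common factor p^2 the sum is \<open>\<phi> + P * \<beta>\<close>. Thus
  \<open>\<phi>\<close> is needed modulo p^2 and \<open>\<beta>\<close> only modulo p, where the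
  Fermat quotient and the Euler number come in.\<close>

lemma wz_sum_cong:
  defines "e \<equiv> (- 1 :: rat) ^ n" and "q \<equiv> fermat_quotient p 2" and "E \<equiv> euler_number (p - 3)"
  shows "[(\<Sum>k=1..n. wz_F n k) \<doteq> 6 * P + (16 * P ^ 2 + 52 * P ^ 3 - 48 * P ^ 3 * q) * e - 12 * P ^ 3 * e * E](4)"
proof -
  define x where "x = rat_of_nat n"
  have P5: "P \<ge> 5" using n_ge by (simp add: P_eq)
  define v w where "v j = (4 * of_nat j + 2) / (of_nat j * (of_nat j - 1) * ((of_nat j + 1) * (of_nat j + 2 :: rat)))"
    and "w j = v j * (1 / (of_nat j + 1) + 1 / (of_nat j + 2) + harmonic (j - 2) + harmonic (j + 2) / 2)
      - 1 / (of_nat j * (of_nat j - 1) * ((of_nat j + 1) * (of_nat j + 2)))" for j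
  define \<phi> \<beta> where "\<phi> = (\<Sum>j=2..<n. (- 1) ^ j * v j)" and "\<beta> = (\<Sum>j=2..<n. (- 1) ^ j * w j)"
  have phi: "\<phi> = e * (2 / x - 1 / (x + 1) - 1 / (x - 1)) + 1/3"
    using alternating_sum_weight[OF n_ge] by (simp only: \<phi>_def v_def e_def x_def)
  have beta: "\<beta> = e * (3/2 * (2 / x - 1 / (x + 1) - 1 / (x - 1)) * harmonic n
        + 4 / x - 11/4 / (x + 1) - 5/4 / (x - 1) - 2 / x ^ 2 + 1 / (x - 1) ^ 2 - 3/2 / (x + 1) ^ 2)
      + 2 * (\<Sum>j=1..n. (- 1) ^ j / of_nat j ^ 2) + 25/12"
    using alternating_sum_harmonic_weight[OF n_ge] by (simp only: \<beta>_def w_def v_def e_def x_def)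
  define a b c where "a = 2 * (1 / (P - 1))" and "b = 2 * (1 / (P + 1))" and "c = 2 * (1 / (P - 3))"
  have inv1: "1 / x = a" "1 / (x + 1) = b" "1 / (x - 1) = c"
    using P5 by (auto simp: x_def a_def b_def c_def P_eq field_simps)
  have inv: "2 / x = 2 * a" "4 / x = 4 * a" "2 / x ^ 2 = 2 * a ^ 2" "1 / (x + 1) = b" "1 / (x - 1) = c"
    "11/4 / (x + 1) = 11 * (1/2 * (1/2)) * b" "5/4 / (x - 1) = 5 * (1/2 * (1/2)) * c"
    "1 / (x - 1) ^ 2 = c ^ 2" "3/2 / (x + 1) ^ 2 = 3 * (1/2) * b ^ 2"
    by (simp_all add: power_divide flip: inv1)
  have abc: "[a \<doteq> - 2 - 2 * P](2)" "[b \<doteq> 2 - 2 * P](2)" "[c \<doteq> - 2/3 - 2/9 * P](2)"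
    using cong_cmult[OF pint_numeral inverse_P_minus_cong(1), of "num.Bit0 num.One"]
      cong_cmult[OF pint_numeral inverse_P_minus_cong(2), of "num.Bit0 num.One"]
      cong_cmult[OF pint_numeral inverse_P_minus_cong(3), of "num.Bit0 num.One"]
    by (simp_all add: a_def b_def c_def algebra_simps)
  have pabc: "pint a" "pint b" "pint c"
    by (auto simp: a_def b_def c_def intro!: pint_mult pint_inverse_P_minus simp del: times_divide_eq_right mult_1_right)
  have pe: "pint e" by (simp add: e_def)
  have leading: "[y \<doteq> u](1)" if "[y \<doteq> u + v * P](2)" "pint v" for y u v
    using cong_trans[OF cong_weaken[OF that(1), of 1] congI[OF that(2), of "u + v * P" u 1]] by simp
  have p23: "pint (- 2 * (1/3) * (1/3))" by (intro pint_mult pint_third pint_minus pint_numeral)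
  have abc1: "[a \<doteq> - 2](1)" "[b \<doteq> 2](1)" "[c \<doteq> - 2 * (1/3)](1)"
    using abc leading[of a "-2" "-2"] leading[of b "2" "-2"] leading[of c "- 2/3" "-2/9"] p23
    by (simp_all add: pint_minus)
  have "[2 * a - b - c \<doteq> 2 * (- 2 - 2 * P) - (2 - 2 * P) - (- 2/3 - 2/9 * P)](2)"
    by (intro cong_diff cong_cmult abc) simp
  also have "2 * (- 2 - 2 * P) - (2 - 2 * P) - (- 2/3 - 2/9 * P) = - 16/3 - 16/9 * P"
    by (simp add: algebra_simps)
  finally have "[2 * a - b - c \<doteq> - 16/3 - 16/9 * P](2)" .
  hence phi_cong: "[\<phi> \<doteq> e * (- 16/3 - 16/9 * P) + 1/3](2)"
    unfolding phi inv by (intro cong_add cong_refl cong_cmult pe)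
  have pE: "pint E" unfolding E_def by (rule euler_number_pint)
  \<comment> \<open>Integrality of the Fermat quotient is read off from its congruence with the
    p-integral \<open>harmonic n\<close>.\<close>
  have "pint (- (1/2) * (- 2 * q))"
    unfolding q_def
    by (intro pint_mult pint_minus pint_half cong_pint[OF cong_sym[OF harmonic_half_cong]] pint_harmonic)
       (simp add: p_eq)
  hence pq: "pint q" by simp
  have beta_cong: "[\<beta> \<doteq> e * (16 * q - 236/9 + 4 * E) + 25/12](1)"
  proof -
    have sq: "[y ^ 2 \<doteq> u ^ 2](1)" if "[y \<doteq> u](1)" "pint y" "pint u" for y u
      unfolding power2_eq_square using that by (intro cong_mult)
    have p32: "pint (3/2)" using pint_mult[OF pint_numeral[of "num.Bit1 num.One"] pint_half] by simp
    have p2: "pint (- 2)" "pint (- 2 * (1/3))" by (intro pint_mult pint_third pint_minus pint_numeral)+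
    note pints = pint_mult pint_half pint_numeral
    have "[\<beta> \<doteq> e * (3 * (1/2) * (2 * (- 2) - 2 - - 2 * (1/3)) * (- 2 * q)
        + 4 * (- 2) - 11 * (1/2 * (1/2)) * 2 - 5 * (1/2 * (1/2)) * (- 2 * (1/3)) - 2 * (- 2) ^ 2
        + (- 2 * (1/3)) ^ 2 - 3 * (1/2) * 2 ^ 2)
      + 2 * (e * (2 * E)) + 25/12](1)"
      unfolding beta inv
    proof (intro cong_add cong_diff cong_cmult pe cong_refl pints cong_mult sq abc1 pabc p2)
      show "[3/2 \<doteq> 3 * (1/2)](1)" by simp
      show "[harmonic n \<doteq> - 2 * q](1)" unfolding q_def by (rule harmonic_half_cong)
      show "[(\<Sum>j=1..n. (- 1) ^ j / of_nat j ^ 2) \<doteq> e * (2 * E)](1)"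
        unfolding e_def E_def by (rule alternating_sum_inverse_squares)
    qed (auto intro!: pint_mult pint_diff pint_minus pabc pq pint_half pint_third p32 simp del: times_divide_eq_right mult_1_right)
    thus ?thesis by (simp add: algebra_simps power2_eq_square add_divide_distrib)
  qed
  have "(\<Sum>k=1..n. wz_F n k) = (\<Sum>k=1..n-2. wz_F n k) + (wz_F n (n - 1) + wz_F n n)"
  proof -
    obtain i where i: "n = Suc (Suc i)" using n_ge by (metis add_2_eq_Suc le_Suc_ex)
    show ?thesis by (simp add: i)
  qed
  also have "(\<Sum>k=1..n-2. wz_F n k) = (\<Sum>j=2..<n. wz_F n (n - j))"
    by (rule sum.reindex_bij_witness[of _ "\<lambda>j. n - j" "\<lambda>k. n - k"]) auto
  also have "[(\<Sum>j=2..<n. wz_F n (n - j)) + (wz_F n (n - 1) + wz_F n n) \<doteq>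
      (\<Sum>j=2..<n. P ^ 2 * (- 3 * (P - 1) ^ 2 * ((- 1) ^ j * v j + P * ((- 1) ^ j * w j))))
      + (6 * P + P ^ 2 + 17/4 * P ^ 3)](4)"
    unfolding v_def w_def by (intro cong_add cong_sum wz_F_cong last_terms_cong) simp_all
  also have "(\<Sum>j=2..<n. P ^ 2 * (- 3 * (P - 1) ^ 2 * ((- 1) ^ j * v j + P * ((- 1) ^ j * w j))))
     = P ^ 2 * (- 3 * (P - 1) ^ 2 * (\<phi> + P ^ 1 * \<beta>))"
    by (simp only: \<phi>_def \<beta>_def sum_distrib_left sum.distrib[symmetric] distrib_left power_one_right)
  also have "[P ^ 2 * (- 3 * (P - 1) ^ 2 * (\<phi> + P ^ 1 * \<beta>)) + (6 * P + P ^ 2 + 17/4 * P ^ 3) \<doteq>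
      P ^ 2 * (- 3 * (P - 1) ^ 2 * ((e * (- 16/3 - 16/9 * P) + 1/3) + P ^ 1 * (e * (16 * q - 236/9 + 4 * E) + 25/12)))
      + (6 * P + P ^ 2 + 17/4 * P ^ 3)](4)"
  proof -
    have "[P ^ 1 * \<beta> \<doteq> P ^ 1 * (e * (16 * q - 236/9 + 4 * E) + 25/12)](1 + 1)"
      by (intro cong_scale beta_cong)
    hence "[\<phi> + P ^ 1 * \<beta> \<doteq> (e * (- 16/3 - 16/9 * P) + 1/3) + P ^ 1 * (e * (16 * q - 236/9 + 4 * E) + 25/12)](2)"
      by (intro cong_add phi_cong) (simp only: one_add_one)
    hence "[P ^ 2 * (- 3 * (P - 1) ^ 2 * (\<phi> + P ^ 1 * \<beta>)) \<doteq> P ^ 2 * (- 3 * (P - 1) ^ 2 *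
        ((e * (- 16/3 - 16/9 * P) + 1/3) + P ^ 1 * (e * (16 * q - 236/9 + 4 * E) + 25/12)))](2 + 2)"
      by (intro cong_scale cong_cmult pint_mult pint_power pint_diff pint_minus) simp_all
    thus ?thesis by (intro cong_add cong_refl) (simp only: numeral_plus_numeral arith_simps)
  qed
  \<comment> \<open>The part without \<open>e\<close> is \<open>- P ^ 2 - 17/4 * P ^ 3\<close> up to
    order 3 and cancels the tail of \<open>last_terms_cong\<close>. In the part with
    \<open>e\<close>, the coefficient 52 arises as 84 - 32. The witness collects the terms of orders
    4 and 5.\<close>
  also have "[P ^ 2 * (- 3 * (P - 1) ^ 2 * ((e * (- 16/3 - 16/9 * P) + 1/3) + P ^ 1 * (e * (16 * q - 236/9 + 4 * E) + 25/12)))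
      + (6 * P + P ^ 2 + 17/4 * P ^ 3) \<doteq>
      6 * P + (16 * P ^ 2 + 52 * P ^ 3 - 48 * P ^ 3 * q) * e - 12 * P ^ 3 * e * E](4)"
  proof (rule congI)
    show "pint (96 * q * e - 152 * e + 24 * E * e + 23 * (1/2)
        - (48 * q * e - 84 * e + 12 * E * e + 25 * (1/2 * (1/2))) * P)"
      by (intro pint_add pint_diff pint_mult pe pE pq pint_half pint_numeral pint_of_nat)
  qed (simp add: algebra_simps power2_eq_square power3_eq_cube power4_eq_xxxx add_divide_distrib)
  finally show ?thesis .
qed

end

section \<open>The supercongruence\<close>

theorem theorem1p1:
  fixes p :: nat
  assumes "prime p" and "p > 2"
  shows "rat_cong_pow p 4
    (\<Sum>k = 0..(p - 3) div 2.
       (92 * of_nat k ^ 2 + 61 * of_nat k + 9) / ((2 * of_nat k + 1) * 64 ^ k)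
         * of_nat ((2 * k) choose k) * of_nat ((3 * k) choose k) * of_nat ((4 * k) choose (2 * k)))
    (6 * of_nat p
      + (16 * of_nat p ^ 2 + 52 * of_nat p ^ 3 - 48 * of_nat p ^ 3 * fermat_quotient p 2)
          * of_int (Legendre (- 1) (int p))
      - 12 * of_nat p ^ 3 * of_int (Legendre (- 1) (int p)) * euler_number (p - 3))"
proof (cases "p = 3")
  case True
  \<comment> \<open>For \<open>p = 3\<close> the sum consists of the single term 9 and the right
    side is 90; they differ by 81, the fourth power of 3.\<close>
  have "Legendre (- 1) (int p) = - 1"
    using Legendre_minus_1[OF assms] True by simp
  moreover have "euler_number 0 = 1"
    using euler_poly_shift[of 0 0] by (simp add: euler_poly_expand)
  ultimately show ?thesis
    using True by (simp add: rat_cong_pow_def fermat_quotient_def p_integral_def)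
next
  case False
  define n where "n = (p - 1) div 2"
  have "odd p" using assms by (metis prime_odd_nat)
  hence p: "p = 2 * n + 1" by (auto simp: n_def elim: oddE)
  interpret prime_gt_3 p n
    using assms False p by unfold_locales auto
  have "{0..(p - 3) div 2} = {..<n}" using p n_ge by auto
  hence sum: "(\<Sum>k = 0..(p - 3) div 2.
       (92 * of_nat k ^ 2 + 61 * of_nat k + 9) / ((2 * of_nat k + 1) * 64 ^ k)
         * of_nat ((2 * k) choose k) * of_nat ((3 * k) choose k) * of_nat ((4 * k) choose (2 * k)))
       = (\<Sum>k=1..n. wz_F n k)"
    using sum_summand_eq_sum_wz_F[of n] n_ge by (simp add: summand_def)
  have "of_int (Legendre (- 1) (int p)) = (- 1 :: rat) ^ n"
    using Legendre_minus_1[OF assms] by (simp add: n_def)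
  thus ?thesis using wz_sum_cong unfolding sum by simp
qed

end
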